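(* Every countable metric space can be extended to a countable ultraextensive metric space; that is, for every countable metric space $X$ there is a countable ultraextensive metric space $Y$ with $X \subseteq Y$ and $d_Y\restriction X = d_X$.
   Context: A metric space $Y$ extends $X$ if $X\subseteq Y$ and $d_Y$ restricted to $X$ equals $d_X$. A partial isometry of a metric space $X$ is an isometry between two finite subsets of $X$; $\mathcal{P}_X$ denotes the set of partial isometries $p$ of $X$ which are not restrictions of the identity (i.e. $p(x)\neq x$ for some $x\in\mathrm{dom}(p)$). For a finite metric space $X$, an S-extension of $X$ is a pair $(Y,\phi)$ where $Y$ is a metric space extending $X$ and $\phi:\mathcal{P}_X\to\mathrm{Iso}(Y)$ satisfies $\phi(p)\restriction\mathrm{dom}(p)=p$ for all $p\in\mathcal{P}_X$; we assume $\phi(p^{-1})=\phi(p)^{-1}$ and extend $\phi$ to a group homomorphism from the free group $\mathbb{F}(\mathcal{P}_X)$ (on generators $\mathcal{P}_X$, with $p^{-1}\in\mathcal{P}_X$ identified with the formal inverse of $p$) to $\mathrm{Iso}(Y)$. $(Y,\phi)$ is minimal if every $y\in Y$ equals $\phi(g)(x)$ for some $g\in\mathbb{F}(\mathcal{P}_X)$ and $x\in X$. If $X_1\subseteq X_2$ are finite metric spaces (so $\mathcal{P}_{X_1}\subseteq\mathcal{P}_{X_2}$) and $(Y_i,\phi_i)$ is an S-extension of $X_i$, then $(Y_1,\phi_1)$ and $(Y_2,\phi_2)$ are coherent if (i) $Y_2$ extends $Y_1$, (ii) $\phi_2(p)$ extends $\phi_1(p)$ for all $p\in\mathcal{P}_{X_1}$,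 and (iii) letting $K_i=\phi_i(\mathbb{F}(\mathcal{P}_{X_i}))\le\mathrm{Iso}(Y_i)$, the assignment $\phi_1(p)\mapsto\phi_2(p)$ ($p\in\mathcal{P}_{X_1}$) extends uniquely to an injective group homomorphism $K_1\to K_2$. A metric space $U$ is ultraextensive if: (i) $U$ is ultrahomogeneous (every partial isometry of $U$ extends to an isometry of $U$); (ii) every finite $X\subseteq U$ has a finite S-extension $(Y,\phi)$ with $Y\subseteq U$ (with the metric of $U$); (iii) whenever $X_1\subseteq X_2\subseteq U$ are finite and $(Y_1,\phi_1)$ is a finite minimal S-extension of $X_1$ with $Y_1\subseteq U$, there is a finite minimal S-extension $(Y_2,\phi_2)$ of $X_2$ with $Y_2\subseteq U$ such that $(Y_1,\phi_1)$ and $(Y_2,\phi_2)$ are coherent. *)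

theory Defs
  imports "HOL-Analysis.Analysis" "HOL-Algebra.Bij"
begin

section \<open>Extensions and isometries of metric spaces\<close>

definition metric_extends :: "'a metric \<Rightarrow> 'a metric \<Rightarrow> bool"
  where "metric_extends Y X \<longleftrightarrow>
    mspace X \<subseteq> mspace Y \<and> (\<forall>x\<in>mspace X. \<forall>y\<in>mspace X. mdist Y x y = mdist X x y)"

definition Isom :: "'a metric \<Rightarrow> ('a \<Rightarrow> 'a) set"
  where "Isom Y = {f \<in> Bij (mspace Y).
    \<forall>x\<in>mspace Y. \<forall>y\<in>mspace Y. mdist Y (f x) (f y) = mdist Y x y}"

definition Isom_group :: "'a metric \<Rightarrow> ('a \<Rightarrow> 'a) monoid"
  where "Isom_group Y = BijGroup (mspace Y) \<lparr>carrier := Isom Y\<rparr>"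

text \<open>A partial isometry is a partial map \<open>p\<close> regarded as a map from \<open>dom p\<close> onto \<open>ran p\<close>.\<close>

definition partial_isometries :: "'a metric \<Rightarrow> ('a \<rightharpoonup> 'a) set"
  where "partial_isometries X = {p. finite (dom p) \<and> dom p \<subseteq> mspace X \<and> ran p \<subseteq> mspace X \<and>
    (\<forall>x\<in>dom p. \<forall>y\<in>dom p. mdist X (the (p x)) (the (p y)) = mdist X x y)}"

definition nonid_partial_isometries :: "'a metric \<Rightarrow> ('a \<rightharpoonup> 'a) set"
  where "nonid_partial_isometries X = {p \<in> partial_isometries X. \<exists>x\<in>dom p. p x \<noteq> Some x}"

definition extends_partial :: "('a \<Rightarrow> 'a) \<Rightarrow> ('a \<rightharpoonup> 'a) \<Rightarrow> bool"
  where "extends_partial f p \<longleftrightarrow> (\<forall>x\<in>dom p. p x = Some (f x))"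

text \<open>The inverse of a partial map; only meaningful for injective ones.\<close>

definition pinv :: "('a \<rightharpoonup> 'a) \<Rightarrow> ('a \<rightharpoonup> 'a)"
  where "pinv p = (\<lambda>y. if y \<in> ran p then Some (THE x. p x = Some y) else None)"

section \<open>The free group on generators closed under formal inversion\<close>

text \<open>Words over \<open>S\<close> modulo cancellation of \<open>s\<close> against \<open>i s\<close>, where \<open>i\<close> is an involution of
  \<open>S\<close> whose value \<open>i s\<close> plays the role of the formal inverse of \<open>s\<close>.  A generator with
  \<open>i s = s\<close> is identified with its own inverse.\<close>

definition cancel_step :: "'g set \<Rightarrow> ('g \<Rightarrow> 'g) \<Rightarrow> ('g list \<times> 'g list) set"
  where "cancel_step S i = {(u @ [s, i s] @ v, u @ v) | u s v. u \<in> lists S \<and> s \<in> S \<and> v \<in> lists S}"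

definition word_eq :: "'g set \<Rightarrow> ('g \<Rightarrow> 'g) \<Rightarrow> ('g list \<times> 'g list) set"
  where "word_eq S i = {(a, b). a \<in> lists S \<and> b \<in> lists S \<and>
    (a, b) \<in> (cancel_step S i \<union> (cancel_step S i)\<inverse>)\<^sup>*}"

definition free_group :: "'g set \<Rightarrow> ('g \<Rightarrow> 'g) \<Rightarrow> 'g list set monoid"
  where "free_group S i =
    \<lparr>carrier = lists S // word_eq S i,
     mult = \<lambda>A B. \<Union>a\<in>A. \<Union>b\<in>B. word_eq S i `` {a @ b},
     one = word_eq S i `` {[]}\<rparr>"

definition word_value :: "('b, 'c) monoid_scheme \<Rightarrow> ('g \<Rightarrow> 'b) \<Rightarrow> 'g list \<Rightarrow> 'b"
  where "word_value G f w = foldr (\<lambda>s x. f s \<otimes>\<^bsub>G\<^esub> x) w \<one>\<^bsub>G\<^esub>"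

text \<open>The homomorphic extension of \<open>f\<close> to \<open>free_group S i\<close>, evaluating a class of words at any
  of its representatives; see \<open>free_lift_class\<close>, \<open>free_lift_hom\<close> and \<open>free_lift_generator\<close> below.\<close>

definition free_lift :: "('b, 'c) monoid_scheme \<Rightarrow> ('g \<Rightarrow> 'b) \<Rightarrow> 'g list set \<Rightarrow> 'b"
  where "free_lift G f A = the_elem (word_value G f ` A)"

abbreviation FP :: "'a metric \<Rightarrow> ('a \<rightharpoonup> 'a) list set monoid"
  where "FP X \<equiv> free_group (nonid_partial_isometries X) pinv"

section \<open>S-extensions\<close>

definition S_extension :: "'a metric \<Rightarrow> 'a metric \<Rightarrow> (('a \<rightharpoonup> 'a) \<Rightarrow> ('a \<Rightarrow> 'a)) \<Rightarrow> bool"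
  where "S_extension X Y \<phi> \<longleftrightarrow>
    finite (mspace X) \<and> metric_extends Y X \<and>
    (\<forall>p\<in>nonid_partial_isometries X. \<phi> p \<in> Isom Y \<and> extends_partial (\<phi> p) p \<and>
      \<phi> (pinv p) = inv\<^bsub>Isom_group Y\<^esub> (\<phi> p))"

definition minimal_S_extension :: "'a metric \<Rightarrow> 'a metric \<Rightarrow> (('a \<rightharpoonup> 'a) \<Rightarrow> ('a \<Rightarrow> 'a)) \<Rightarrow> bool"
  where "minimal_S_extension X Y \<phi> \<longleftrightarrow> S_extension X Y \<phi> \<and>
    (\<forall>y\<in>mspace Y. \<exists>g\<in>carrier (FP X). \<exists>x\<in>mspace X. y = free_lift (Isom_group Y) \<phi> g x)"

definition image_group :: "'a metric \<Rightarrow> 'a metric \<Rightarrow> (('a \<rightharpoonup> 'a) \<Rightarrow> ('a \<Rightarrow> 'a)) \<Rightarrow> ('a \<Rightarrow> 'a) monoid"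
  where "image_group X Y \<phi> =
    Isom_group Y \<lparr>carrier := free_lift (Isom_group Y) \<phi> ` carrier (FP X)\<rparr>"

text \<open>Homomorphisms are taken to be extensional so that uniqueness is about their values on the
  domain group only.\<close>

definition coherent :: "'a metric \<Rightarrow> 'a metric \<Rightarrow> (('a \<rightharpoonup> 'a) \<Rightarrow> ('a \<Rightarrow> 'a)) \<Rightarrow>
    'a metric \<Rightarrow> 'a metric \<Rightarrow> (('a \<rightharpoonup> 'a) \<Rightarrow> ('a \<Rightarrow> 'a)) \<Rightarrow> bool"
  where "coherent X\<^sub>1 Y\<^sub>1 \<phi>\<^sub>1 X\<^sub>2 Y\<^sub>2 \<phi>\<^sub>2 \<longleftrightarrow>
    metric_extends Y\<^sub>2 Y\<^sub>1 \<and>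
    (\<forall>p\<in>nonid_partial_isometries X\<^sub>1. \<forall>y\<in>mspace Y\<^sub>1. \<phi>\<^sub>2 p y = \<phi>\<^sub>1 p y) \<and>
    (\<exists>!h. h \<in> mon (image_group X\<^sub>1 Y\<^sub>1 \<phi>\<^sub>1) (image_group X\<^sub>2 Y\<^sub>2 \<phi>\<^sub>2) \<and>
          h \<in> extensional (carrier (image_group X\<^sub>1 Y\<^sub>1 \<phi>\<^sub>1)) \<and>
          (\<forall>p\<in>nonid_partial_isometries X\<^sub>1. h (\<phi>\<^sub>1 p) = \<phi>\<^sub>2 p))"

definition ultrahomogeneous :: "'a metric \<Rightarrow> bool"
  where "ultrahomogeneous U \<longleftrightarrow> (\<forall>p\<in>partial_isometries U. \<exists>f\<in>Isom U. extends_partial f p)"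

definition ultraextensive :: "'a metric \<Rightarrow> bool"
  where "ultraextensive U \<longleftrightarrow>
    ultrahomogeneous U \<and>
    (\<forall>X. finite X \<and> X \<subseteq> mspace U \<longrightarrow>
      (\<exists>Y \<phi>. finite Y \<and> Y \<subseteq> mspace U \<and> S_extension (submetric U X) (submetric U Y) \<phi>)) \<and>
    (\<forall>X\<^sub>1 X\<^sub>2 Y\<^sub>1 \<phi>\<^sub>1. X\<^sub>1 \<subseteq> X\<^sub>2 \<and> X\<^sub>2 \<subseteq> mspace U \<and> finite X\<^sub>2 \<and> Y\<^sub>1 \<subseteq> mspace U \<and> finite Y\<^sub>1 \<and>
      minimal_S_extension (submetric U X\<^sub>1) (submetric U Y\<^sub>1) \<phi>\<^sub>1 \<longrightarrow>
      (\<exists>Y\<^sub>2 \<phi>\<^sub>2. Y\<^sub>2 \<subseteq> mspace U \<and> finite Y\<^sub>2 \<and>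
        minimal_S_extension (submetric U X\<^sub>2) (submetric U Y\<^sub>2) \<phi>\<^sub>2 \<and>
        coherent (submetric U X\<^sub>1) (submetric U Y\<^sub>1) \<phi>\<^sub>1 (submetric U X\<^sub>2) (submetric U Y\<^sub>2) \<phi>\<^sub>2))"

section \<open>Basic facts about the notions above\<close>

lemma group_Isom_group: "group (Isom_group Y)"
proof -
  interpret B: group "BijGroup (mspace Y)" by (rule group_BijGroup)
  have "subgroup (Isom Y) (BijGroup (mspace Y))"
  proof (rule B.subgroupI)
    show "Isom Y \<subseteq> carrier (BijGroup (mspace Y))"
      by (auto simp: Isom_def BijGroup_def)
    have "(\<lambda>x\<in>mspace Y. x) \<in> Isom Y" by (auto simp: Isom_def id_Bij)
    then show "Isom Y \<noteq> {}" by blast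
  next
    fix f assume f: "f \<in> Isom Y"
    then have fB: "f \<in> Bij (mspace Y)" by (simp add: Isom_def)
    then have bij: "bij_betw f (mspace Y) (mspace Y)" by (simp add: Bij_def)
    have "inv\<^bsub>BijGroup (mspace Y)\<^esub> f = (\<lambda>x\<in>mspace Y. inv_into (mspace Y) f x)"
      using fB by (rule inv_BijGroup)
    moreover have "mdist Y (inv_into (mspace Y) f x) (inv_into (mspace Y) f y) = mdist Y x y"
      if "x \<in> mspace Y" "y \<in> mspace Y" for x y
    proof -
      have "inv_into (mspace Y) f x \<in> mspace Y" "inv_into (mspace Y) f y \<in> mspace Y"
        using that Bij_inv_into_mem[OF fB] by auto
      moreover have "f (inv_into (mspace Y) f x) = x" "f (inv_into (mspace Y) f y) = y"
        using that bij by (auto simp: bij_betw_inv_into_right)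
      ultimately show ?thesis using f unfolding Isom_def by force
    qed
    ultimately show "inv\<^bsub>BijGroup (mspace Y)\<^esub> f \<in> Isom Y"
      using restrict_inv_into_Bij[OF fB] by (simp add: Isom_def)
  next
    fix f g assume "f \<in> Isom Y" "g \<in> Isom Y"
    then show "f \<otimes>\<^bsub>BijGroup (mspace Y)\<^esub> g \<in> Isom Y"
      using compose_Bij[of f "mspace Y" g] Bij_imp_funcset[of g "mspace Y"]
      by (auto simp: Isom_def BijGroup_def compose_def Pi_iff)
  qed
  then show ?thesis unfolding Isom_group_def by (rule B.subgroup_imp_group)
qed

lemma partial_isometry_inj:
  assumes p: "p \<in> partial_isometries X" and eq: "p x = Some z" "p y = Some z"
  shows "x = y"
proof -
  have xy: "x \<in> dom p" "y \<in> dom p" using eq by auto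
  moreover have "z \<in> ran p" using eq by (auto intro: ranI)
  ultimately have X: "x \<in> mspace X" "y \<in> mspace X" "z \<in> mspace X"
    using p by (auto simp: partial_isometries_def)
  have "mdist X x y = mdist X z z" using p xy eq unfolding partial_isometries_def by force
  also have "\<dots> = 0" using X by simp
  finally show ?thesis using X by simp
qed

lemma pinv_eq_Some_iff:
  assumes "p \<in> partial_isometries X"
  shows "pinv p y = Some x \<longleftrightarrow> p x = Some y"
proof
  assume "pinv p y = Some x"
  then have *: "y \<in> ran p" "x = (THE x. p x = Some y)"
    by (auto simp: pinv_def split: if_splits)
  then obtain x' where x': "p x' = Some y" by (auto simp: ran_def)
  then have "(THE x. p x = Some y) = x'"
    using partial_isometry_inj[OF assms] by blast
  then show "p x = Some y" using * x' by simp
next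
  assume x: "p x = Some y"
  then have "(THE x. p x = Some y) = x"
    using partial_isometry_inj[OF assms] by blast
  then show "pinv p y = Some x" using x by (auto simp: pinv_def intro: ranI)
qed

lemma pinv_partial_isometries:
  assumes p: "p \<in> partial_isometries X"
  shows "pinv p \<in> partial_isometries X"
proof -
  note iff = pinv_eq_Some_iff[OF p]
  have d: "dom (pinv p) = ran p" by (auto simp: dom_def ran_def iff)
  have r: "ran (pinv p) = dom p" by (auto simp: dom_def ran_def iff)
  have "finite (ran p)" using p by (simp add: partial_isometries_def finite_ran)
  moreover have "mdist X (the (pinv p x)) (the (pinv p y)) = mdist X x y"
    if "x \<in> ran p" "y \<in> ran p" for x y
  proof -
    from that obtain x' y' where "p x' = Some x" "p y' = Some y" by (auto simp: ran_def)
    moreover from this have "pinv p x = Some x'" "pinv p y = Some y'" by (simp_all add: iff)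
    ultimately show ?thesis using p unfolding partial_isometries_def by force
  qed
  ultimately show ?thesis using p by (auto simp: partial_isometries_def d r)
qed

lemma pinv_pinv:
  assumes p: "p \<in> partial_isometries X"
  shows "pinv (pinv p) = p"
proof (rule ext)
  fix x
  have "pinv (pinv p) x = Some y \<longleftrightarrow> p x = Some y" for y
    using pinv_eq_Some_iff[OF p] pinv_eq_Some_iff[OF pinv_partial_isometries[OF p]] by simp
  then show "pinv (pinv p) x = p x" by (metis not_Some_eq)
qed

lemma pinv_nonid_partial_isometries:
  assumes "p \<in> nonid_partial_isometries X"
  shows "pinv p \<in> nonid_partial_isometries X"
proof -
  from assms obtain x y where p: "p \<in> partial_isometries X" and y: "p x = Some y" "y \<noteq> x"
    by (auto simp: nonid_partial_isometries_def)
  have "pinv p y = Some x" using y by (simp add: pinv_eq_Some_iff[OF p])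
  then have "y \<in> dom (pinv p)" "pinv p y \<noteq> Some y" using y by auto
  then show ?thesis using pinv_partial_isometries[OF p]
    unfolding nonid_partial_isometries_def by blast
qed

lemma equiv_word_eq: "equiv (lists S) (word_eq S i)"
proof (rule equivI)
  show "word_eq S i \<subseteq> lists S \<times> lists S" by (auto simp: word_eq_def)
  show "refl_on (lists S) (word_eq S i)" by (auto simp: refl_on_def word_eq_def)
  have "sym ((cancel_step S i \<union> (cancel_step S i)\<inverse>)\<^sup>*)"
    by (intro sym_rtrancl sym_Un_converse)
  then show "sym (word_eq S i)" unfolding sym_def word_eq_def by blast
  show "trans (word_eq S i)"
    unfolding trans_def word_eq_def by (auto intro: rtrancl_trans)
qed

lemma word_eq_trans:
  "(a, b) \<in> word_eq S i \<Longrightarrow> (b, c) \<in> word_eq S i \<Longrightarrow> (a, c) \<in> word_eq S i"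
  using equiv_word_eq[of S i] by (auto simp: equiv_def dest: transD)

lemma word_eq_context:
  assumes ab: "(a, b) \<in> word_eq S i" and u: "u \<in> lists S" and v: "v \<in> lists S"
  shows "(u @ a @ v, u @ b @ v) \<in> word_eq S i"
proof -
  let ?R = "cancel_step S i \<union> (cancel_step S i)\<inverse>"
  have ctxt: "(u @ x @ v, u @ y @ v) \<in> cancel_step S i" if "(x, y) \<in> cancel_step S i" for x y
  proof -
    from that obtain u' s v' where *: "x = u' @ [s, i s] @ v'" "y = u' @ v'"
      "u' \<in> lists S" "s \<in> S" "v' \<in> lists S" unfolding cancel_step_def by blast
    have "u @ x @ v = (u @ u') @ [s, i s] @ (v' @ v)" "u @ y @ v = (u @ u') @ (v' @ v)"
      using * by simp_all
    moreover have "u @ u' \<in> lists S" "v' @ v \<in> lists S" using * u v by auto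
    ultimately show ?thesis using \<open>s \<in> S\<close> unfolding cancel_step_def by blast
  qed
  have "(a, b) \<in> ?R\<^sup>*" using ab by (simp add: word_eq_def)
  then have "(u @ a @ v, u @ b @ v) \<in> ?R\<^sup>*"
  proof induction
    case (step y z)
    then have "(u @ y @ v, u @ z @ v) \<in> ?R" using ctxt step.hyps(2) by blast
    with step.IH show ?case by (rule rtrancl_into_rtrancl)
  qed simp
  then show ?thesis using ab u v by (auto simp: word_eq_def)
qed

lemma word_eq_append:
  assumes "(a, a') \<in> word_eq S i" "(b, b') \<in> word_eq S i"
  shows "(a @ b, a' @ b') \<in> word_eq S i"
proof -
  have L: "a \<in> lists S" "a' \<in> lists S" "b \<in> lists S" "b' \<in> lists S"
    using assms by (auto simp: word_eq_def)
  have "(a @ b, a' @ b) \<in> word_eq S i" using word_eq_context[OF assms(1) _ L(3), of "[]"] by simp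
  moreover have "(a' @ b, a' @ b') \<in> word_eq S i"
    using word_eq_context[OF assms(2) L(2), of "[]"] by simp
  ultimately show ?thesis by (rule word_eq_trans)
qed

lemma UN2_constant:
  assumes "A \<noteq> {}" "B \<noteq> {}" "\<And>x y. x \<in> A \<Longrightarrow> y \<in> B \<Longrightarrow> F x y = C"
  shows "(\<Union>x\<in>A. \<Union>y\<in>B. F x y) = C"
  using assms by simp

lemma free_group_mult_class:
  assumes "a \<in> lists S" "b \<in> lists S"
  shows "word_eq S i `` {a} \<otimes>\<^bsub>free_group S i\<^esub> word_eq S i `` {b} = word_eq S i `` {a @ b}"
proof -
  have E: "equiv (lists S) (word_eq S i)" by (rule equiv_word_eq)
  have "word_eq S i `` {a' @ b'} = word_eq S i `` {a @ b}"
    if "(a, a') \<in> word_eq S i" "(b, b') \<in> word_eq S i" for a' b'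
    using equiv_class_eq[OF E word_eq_append[OF that]] by simp
  moreover have "(a, a) \<in> word_eq S i" "(b, b) \<in> word_eq S i"
    using assms by (auto simp: word_eq_def)
  ultimately have "(\<Union>a'\<in>word_eq S i `` {a}. \<Union>b'\<in>word_eq S i `` {b}. word_eq S i `` {a' @ b'})
      = word_eq S i `` {a @ b}"
    by (intro UN2_constant) (blast+)
  then show ?thesis by (simp add: free_group_def)
qed

lemma free_group_carrierE:
  assumes "A \<in> carrier (free_group S i)"
  obtains a where "a \<in> lists S" "A = word_eq S i `` {a}"
proof -
  have "A \<in> lists S // word_eq S i" using assms by (simp add: free_group_def)
  then show thesis by (rule quotientE) (rule that)
qed

lemma free_group_class_carrier:
  "a \<in> lists S \<Longrightarrow> word_eq S i `` {a} \<in> carrier (free_group S i)"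
  by (auto simp: free_group_def intro: quotientI)

lemma word_eq_inverse:
  assumes i: "\<And>s. s \<in> S \<Longrightarrow> i s \<in> S" "\<And>s. s \<in> S \<Longrightarrow> i (i s) = s" and "w \<in> lists S"
  shows "(rev (map i w) @ w, []) \<in> word_eq S i"
  using \<open>w \<in> lists S\<close>
proof (induction w)
  case Nil
  show ?case by (auto simp: word_eq_def)
next
  case (Cons s w)
  let ?u = "rev (map i w)"
  have u: "?u \<in> lists S" using Cons.hyps i by auto
  have eq: "rev (map i (s # w)) @ (s # w) = ?u @ [i s, i (i s)] @ w"
    using Cons.hyps i by simp
  have "(?u @ [i s, i (i s)] @ w, ?u @ w) \<in> cancel_step S i"
    using u Cons.hyps i unfolding cancel_step_def by blast
  then have "(rev (map i (s # w)) @ (s # w), ?u @ w) \<in> word_eq S i"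
    unfolding eq using u Cons.hyps i by (auto simp: word_eq_def)
  then show ?case using Cons.IH by (rule word_eq_trans)
qed

lemma group_free_group:
  assumes i: "\<And>s. s \<in> S \<Longrightarrow> i s \<in> S" "\<And>s. s \<in> S \<Longrightarrow> i (i s) = s"
  shows "group (free_group S i)"
proof (rule groupI)
  let ?F = "free_group S i" and ?E = "\<lambda>w. word_eq S i `` {w}"
  have one: "\<one>\<^bsub>?F\<^esub> = ?E []" by (simp add: free_group_def)
  show "\<one>\<^bsub>?F\<^esub> \<in> carrier ?F" unfolding one by (rule free_group_class_carrier) simp
  fix A assume "A \<in> carrier ?F"
  then obtain a where a: "a \<in> lists S" "A = ?E a" by (rule free_group_carrierE)
  show "\<one>\<^bsub>?F\<^esub> \<otimes>\<^bsub>?F\<^esub> A = A" using a by (simp add: one free_group_mult_class)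
  have r: "rev (map i a) \<in> lists S" using a i by auto
  have "?E (rev (map i a)) \<otimes>\<^bsub>?F\<^esub> A = ?E (rev (map i a) @ a)"
    using a r by (simp add: free_group_mult_class)
  also have "\<dots> = \<one>\<^bsub>?F\<^esub>"
    unfolding one by (rule equiv_class_eq[OF equiv_word_eq word_eq_inverse[OF i a(1)]])
  finally show "\<exists>B\<in>carrier ?F. B \<otimes>\<^bsub>?F\<^esub> A = \<one>\<^bsub>?F\<^esub>"
    using free_group_class_carrier[OF r, of i] by blast
  fix B assume "B \<in> carrier ?F"
  then obtain b where b: "b \<in> lists S" "B = ?E b" by (rule free_group_carrierE)
  have ab: "a @ b \<in> lists S" using a b by auto
  show "A \<otimes>\<^bsub>?F\<^esub> B \<in> carrier ?F"
    using a b ab free_group_class_carrier[OF ab, of i] by (simp add: free_group_mult_class)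
  fix C assume "C \<in> carrier ?F"
  then obtain c where c: "c \<in> lists S" "C = ?E c" by (rule free_group_carrierE)
  have bc: "b @ c \<in> lists S" using b c by auto
  show "A \<otimes>\<^bsub>?F\<^esub> B \<otimes>\<^bsub>?F\<^esub> C = A \<otimes>\<^bsub>?F\<^esub> (B \<otimes>\<^bsub>?F\<^esub> C)"
    using a b c ab bc by (simp add: free_group_mult_class del: append_in_lists_conv)
qed

context
  fixes G :: "('b, 'c) monoid_scheme" (structure) and S :: "'g set"
    and i :: "'g \<Rightarrow> 'g" and f :: "'g \<Rightarrow> 'b"
  assumes G: "group G"
    and f: "\<And>s. s \<in> S \<Longrightarrow> f s \<in> carrier G"
    and f_i: "\<And>s. s \<in> S \<Longrightarrow> f (i s) = inv (f s)"
begin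

interpretation group G by (rule G)

lemma word_value_closed: "w \<in> lists S \<Longrightarrow> word_value G f w \<in> carrier G"
  by (induction w) (auto simp: word_value_def f)

lemma word_value_append:
  "u \<in> lists S \<Longrightarrow> v \<in> lists S \<Longrightarrow> word_value G f (u @ v) = word_value G f u \<otimes> word_value G f v"
proof (induction u)
  case Nil
  then show ?case using word_value_closed[of v] by (simp add: word_value_def)
next
  case (Cons s u)
  then show ?case using word_value_closed[of v] word_value_closed[of u]
    by (auto simp: word_value_def f m_assoc)
qed

lemma word_value_cong:
  assumes "(a, b) \<in> word_eq S i"
  shows "word_value G f a = word_value G f b"
proof -
  have 1: "word_value G f x = word_value G f y" if "(x, y) \<in> cancel_step S i" for x y
  proof -
    from that obtain u s v where *: "x = u @ [s, i s] @ v" "y = u @ v"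
      "u \<in> lists S" "s \<in> S" "v \<in> lists S" unfolding cancel_step_def by blast
    have "word_value G f ([s, i s] @ v) = f s \<otimes> (inv (f s) \<otimes> word_value G f v)"
      using * by (simp add: word_value_def f_i)
    also have "\<dots> = word_value G f v"
      using * word_value_closed[of v] f by (simp flip: m_assoc)
    finally have "word_value G f ([s, i s] @ v) = word_value G f v" .
    moreover have "word_value G f x = word_value G f u \<otimes> word_value G f ([s, i s] @ v)"
    proof (cases "i s \<in> S")
      case True
      then show ?thesis unfolding *(1) using * by (intro word_value_append) auto
    next
      case False
      have "word_value G f (u @ w) = word_value G f u \<otimes> word_value G f w"
        if "word_value G f w \<in> carrier G" for w
        using \<open>u \<in> lists S\<close>
      proof (induction u)
        case Nil
        then show ?case using that by (simp add: word_value_def)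
      next
        case (Cons t u)
        then show ?case using that word_value_closed[of u] by (auto simp: word_value_def f m_assoc)
      qed
      moreover have "word_value G f ([s, i s] @ v) \<in> carrier G"
        using * word_value_closed[of v] f by (simp add: word_value_def f_i)
      ultimately show ?thesis unfolding *(1) by blast
    qed
    ultimately show ?thesis using * by (simp add: word_value_append)
  qed
  have "(a, b) \<in> (cancel_step S i \<union> (cancel_step S i)\<inverse>)\<^sup>*"
    using assms by (simp add: word_eq_def)
  then show ?thesis
  proof induction
    case (step y z)
    then show ?case using 1[of y z] 1[of z y] by auto
  qed simp
qed

lemma free_lift_class:
  assumes "w \<in> lists S"
  shows "free_lift G f (word_eq S i `` {w}) = word_value G f w"
proof -
  have "(w, w) \<in> word_eq S i" using assms by (auto simp: word_eq_def)
  moreover have "word_value G f v = word_value G f w" if "(w, v) \<in> word_eq S i" for v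
    using word_value_cong[OF that] by (rule sym)
  ultimately have "word_value G f ` (word_eq S i `` {w}) = {word_value G f w}" by blast
  then show ?thesis by (simp add: free_lift_def)
qed

lemma free_lift_hom: "free_lift G f \<in> hom (free_group S i) G"
proof (rule homI)
  fix A assume "A \<in> carrier (free_group S i)"
  then obtain a where a: "a \<in> lists S" "A = word_eq S i `` {a}" by (rule free_group_carrierE)
  then show "free_lift G f A \<in> carrier G" by (simp add: free_lift_class word_value_closed)
  fix B assume "B \<in> carrier (free_group S i)"
  then obtain b where b: "b \<in> lists S" "B = word_eq S i `` {b}" by (rule free_group_carrierE)
  have "a @ b \<in> lists S" using a b by auto
  then show "free_lift G f (A \<otimes>\<^bsub>free_group S i\<^esub> B) = free_lift G f A \<otimes> free_lift G f B"
    using a b by (simp add: free_group_mult_class free_lift_class word_value_append del: append_in_lists_conv)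
qed

lemma free_lift_generator: "s \<in> S \<Longrightarrow> free_lift G f (word_eq S i `` {[s]}) = f s"
  using free_lift_class[of "[s]"] by (simp add: word_value_def f)

end

lemma group_FP: "group (FP X)"
proof (rule group_free_group)
  fix p assume p: "p \<in> nonid_partial_isometries X"
  then show "pinv p \<in> nonid_partial_isometries X" by (rule pinv_nonid_partial_isometries)
  have "p \<in> partial_isometries X" using p by (simp add: nonid_partial_isometries_def)
  then show "pinv (pinv p) = p" by (rule pinv_pinv)
qed

end

theory Submission
  imports Defs
begin

text \<open>
  The heart of the matter is a coherent extension property: a finite metric space \<open>X\<close> has a finite
  extension \<open>Y\<close> in which all partial isometries \<open>p\<close> of \<open>X\<close> extend to isometries \<open>\<Phi> p\<close> with
  \<open>\<Phi> (q \<circ> p) = \<Phi> q \<circ> \<Phi> p\<close> whenever \<open>dom q = ran p\<close>.  Following Hubicka, Konecny and Nesetril, one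
  starts with the complete graph on \<open>X\<close> in which every edge carries all distances of \<open>X\<close> as labels, and
  removes bad walks (walks that are cheaper than some label of the edge joining their ends) in order of
  their length, by passing to graphs whose vertices carry one additional bit for each bad walk.  Bad
  walks have bounded length, so finitely many steps suffice, and in a graph without bad walks the path
  metric restricts to the metric of \<open>X\<close>.

  Amalgamating such extensions along a chain yields a countable space \<open>U\<close> all of whose finite subsets
  have coherent extensions inside \<open>U\<close>.  Ultrahomogeneity follows by back-and-forth.  Given a minimal
  S-extension \<open>Y\<^sub>1\<close> of \<open>X\<^sub>1\<close> and \<open>X\<^sub>2 \<supseteq> X\<^sub>1\<close>, one takes a coherent extension of \<open>X\<^sub>2 \<union> Y\<^sub>1\<close>: since
  isometries of \<open>Y\<^sub>1\<close> are partial isometries of \<open>X\<^sub>2 \<union> Y\<^sub>1\<close>, all relations between them persist.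
\<close>

section \<open>Composition of partial isometries\<close>

lemma partial_isometriesD:
  assumes "p \<in> partial_isometries X"
  shows "finite (dom p)" "dom p \<subseteq> mspace X" "ran p \<subseteq> mspace X"
    and "\<And>x y. x \<in> dom p \<Longrightarrow> y \<in> dom p \<Longrightarrow> mdist X (the (p x)) (the (p y)) = mdist X x y"
  using assms by (auto simp: partial_isometries_def)

lemma the_in_ran: "x \<in> dom p \<Longrightarrow> the (p x) \<in> ran p"
  by (auto simp: ran_def)

lemma partial_isometry_bij_betw:
  assumes "p \<in> partial_isometries X"
  shows "bij_betw (\<lambda>x. the (p x)) (dom p) (ran p)"
  unfolding bij_betw_def
proof
  show "inj_on (\<lambda>x. the (p x)) (dom p)"
    using partial_isometry_inj[OF assms] by (fastforce intro: inj_onI)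
  show "(\<lambda>x. the (p x)) ` dom p = ran p"
    by (force simp: ran_def)
qed

lemma dom_map_comp:
  assumes "dom q = ran p"
  shows "dom (q \<circ>\<^sub>m p) = dom p"
proof -
  have "\<exists>z. q y = Some z" if "p x = Some y" for x y
    using assms that by (metis domD ranI)
  then show ?thesis by (force simp: map_comp_def dom_def split: option.splits)
qed

lemma map_comp_apply:
  assumes "dom q = ran p" "x \<in> dom p"
  shows "the ((q \<circ>\<^sub>m p) x) = the (q (the (p x)))"
  using assms by (auto simp: map_comp_def)

lemma partial_isometry_map_comp:
  assumes p: "p \<in> partial_isometries X" and q: "q \<in> partial_isometries X" and dq: "dom q = ran p"
  shows "q \<circ>\<^sub>m p \<in> partial_isometries X"
proof -
  have "ran (q \<circ>\<^sub>m p) \<subseteq> ran q"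
    by (auto simp: ran_def map_comp_def split: option.splits)
  moreover have "mdist X (the ((q \<circ>\<^sub>m p) x)) (the ((q \<circ>\<^sub>m p) y)) = mdist X x y"
    if "x \<in> dom p" "y \<in> dom p" for x y
    using that partial_isometriesD(4)[OF p] partial_isometriesD(4)[OF q] dq
    by (simp add: map_comp_apply the_in_ran)
  ultimately show ?thesis
    using partial_isometriesD[OF p] partial_isometriesD[OF q]
    by (auto simp: partial_isometries_def dom_map_comp[OF dq])
qed

lemma dom_pinv:
  assumes "p \<in> partial_isometries X"
  shows "dom (pinv p) = ran p" "ran (pinv p) = dom p"
  by (auto simp: dom_def ran_def pinv_eq_Some_iff[OF assms])

lemma ran_map_comp:
  assumes "dom q = ran p"
  shows "ran (q \<circ>\<^sub>m p) = ran q"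
proof
  show "ran (q \<circ>\<^sub>m p) \<subseteq> ran q"
    by (auto simp: ran_def map_comp_def split: option.splits)
  show "ran q \<subseteq> ran (q \<circ>\<^sub>m p)"
  proof
    fix z assume "z \<in> ran q"
    then obtain y where y: "q y = Some z" by (auto simp: ran_def)
    then obtain x where "p x = Some y" using assms by (auto simp: ran_def dom_def set_eq_iff)
    with y show "z \<in> ran (q \<circ>\<^sub>m p)" by (auto simp: ran_def map_comp_def intro!: exI[of _ x])
  qed
qed

section \<open>Coherent actions\<close>

text \<open>The partial isometries of \<open>X\<close> form a groupoid under composition of pairs
  with \<open>dom q = ran p\<close>. Here \<open>\<Phi>\<close> is a homomorphism from this groupoid
  to the permutations of \<open>V\<close> that extends every \<open>p\<close> along
  \<open>e\<close>. Nothing is required of \<open>\<Phi> p\<close> off \<open>V\<close>.\<close>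

definition coherent_action :: "'a metric \<Rightarrow> 'b set \<Rightarrow> ('a \<Rightarrow> 'b) \<Rightarrow> (('a \<rightharpoonup> 'a) \<Rightarrow> 'b \<Rightarrow> 'b) \<Rightarrow> bool"
  where "coherent_action X V e \<Phi> \<longleftrightarrow>
    (\<forall>p\<in>partial_isometries X. bij_betw (\<Phi> p) V V \<and> (\<forall>x\<in>dom p. \<Phi> p (e x) = e (the (p x)))) \<and>
    (\<forall>p\<in>partial_isometries X. \<forall>q\<in>partial_isometries X. dom q = ran p \<longrightarrow>
      (\<forall>v\<in>V. \<Phi> (q \<circ>\<^sub>m p) v = \<Phi> q (\<Phi> p v)))"

lemma coherent_actionD:
  assumes "coherent_action X V e \<Phi>"
  shows "p \<in> partial_isometries X \<Longrightarrow> bij_betw (\<Phi> p) V V"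
    and "p \<in> partial_isometries X \<Longrightarrow> v \<in> V \<Longrightarrow> \<Phi> p v \<in> V"
    and "p \<in> partial_isometries X \<Longrightarrow> x \<in> dom p \<Longrightarrow> \<Phi> p (e x) = e (the (p x))"
    and "p \<in> partial_isometries X \<Longrightarrow> q \<in> partial_isometries X \<Longrightarrow> dom q = ran p \<Longrightarrow> v \<in> V \<Longrightarrow>
      \<Phi> (q \<circ>\<^sub>m p) v = \<Phi> q (\<Phi> p v)"
  using assms by (auto simp: coherent_action_def dest: bij_betwE)

text \<open>A partial identity is idempotent and composable with itself, so \<open>\<Phi> p\<close>
  is an idempotent permutation of \<open>V\<close>.\<close>

lemma coherent_action_idem:
  assumes \<Phi>: "coherent_action X V e \<Phi>" and p: "p \<in> partial_isometries X"
    and id: "\<And>x. x \<in> dom p \<Longrightarrow> p x = Some x" and v: "v \<in> V"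
  shows "\<Phi> p v = v"
proof -
  have "ran p = dom p"
  proof
    show "ran p \<subseteq> dom p" using id by (fastforce simp: ran_def)
    show "dom p \<subseteq> ran p" using id by (meson ranI subsetI)
  qed
  moreover have "p \<circ>\<^sub>m p = p"
  proof
    show "(p \<circ>\<^sub>m p) x = p x" for x
      using id[of x] by (cases "p x") (auto simp: map_comp_def)
  qed
  ultimately have "\<Phi> p (\<Phi> p v) = \<Phi> p v"
    using coherent_actionD(4)[OF \<Phi> p p _ v] by simp
  then show ?thesis
    using coherent_actionD(1,2)[OF \<Phi> p] v by (metis bij_betw_imp_inj_on inj_onD)
qed

lemma pinv_map_comp:
  assumes p: "p \<in> partial_isometries X" and x: "x \<in> dom p"
  shows "(pinv p \<circ>\<^sub>m p) x = Some x"
  using x pinv_eq_Some_iff[OF p] by (auto simp: map_comp_def)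

lemma coherent_action_pinv:
  assumes \<Phi>: "coherent_action X V e \<Phi>" and p: "p \<in> partial_isometries X" and v: "v \<in> V"
  shows "\<Phi> (pinv p) (\<Phi> p v) = v"
proof -
  have q: "pinv p \<in> partial_isometries X" "dom (pinv p) = ran p"
    using pinv_partial_isometries[OF p] dom_pinv[OF p] by auto
  have "\<Phi> (pinv p \<circ>\<^sub>m p) v = v"
    using partial_isometry_map_comp[OF p q] pinv_map_comp[OF p] dom_map_comp[OF q(2)] v
    by (intro coherent_action_idem[OF \<Phi>]) auto
  then show ?thesis using coherent_actionD(4)[OF \<Phi> p q v] by simp
qed

text \<open>A partial isometry \<open>p\<close> is completed to a permutation through fixed enumerations of the
  complements of \<open>dom p\<close> and \<open>ran p\<close>; fixing them makes the completion compatible with composition.\<close>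

lemma coherent_permutations:
  fixes X :: "'a metric"
  assumes "finite (mspace X)"
  shows "\<exists>\<pi>. coherent_action X (mspace X) (\<lambda>x. x) \<pi>"
proof -
  let ?A = "mspace X"
  have "\<forall>D. \<exists>h. bij_betw h (?A - D) {0..<card (?A - D)}"
    using assms by (intro allI ex_bij_betw_finite_nat) auto
  then obtain h where h: "\<And>D. bij_betw (h D) (?A - D) {0..<card (?A - D)}"
    by metis
  let ?c = "\<lambda>D R x. inv_into (?A - R) (h R) (h D x)"
  define \<pi> where "\<pi> p x = (if x \<in> dom p then the (p x) else ?c (dom p) (ran p) x)" for p x
  have c: "bij_betw (?c (dom p) (ran p)) (?A - dom p) (?A - ran p)"
    if p: "p \<in> partial_isometries X" for p
  proof -
    have "card (dom p) = card (ran p)"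
      using partial_isometry_bij_betw[OF p] by (rule bij_betw_same_card)
    moreover have "finite (dom p)" "finite (ran p)" "dom p \<subseteq> ?A" "ran p \<subseteq> ?A"
      using partial_isometriesD[OF p] assms by (auto intro: finite_subset)
    ultimately have "card (?A - dom p) = card (?A - ran p)"
      by (simp add: card_Diff_subset)
    then show ?thesis
      using bij_betw_trans[OF h[of "dom p"], of "inv_into (?A - ran p) (h (ran p))" "?A - ran p"]
        bij_betw_inv_into[OF h[of "ran p"]]
      by (simp add: comp_def)
  qed
  have \<pi>: "bij_betw (\<pi> p) ?A ?A" if p: "p \<in> partial_isometries X" for p
  proof -
    have "bij_betw (\<pi> p) (dom p \<union> (?A - dom p)) (ran p \<union> (?A - ran p))"
    proof (rule bij_betw_combine)
      show "bij_betw (\<pi> p) (dom p) (ran p)"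
        using partial_isometry_bij_betw[OF p] by (subst bij_betw_cong[of _ _ "\<lambda>x. the (p x)"]) (auto simp: \<pi>_def)
      show "bij_betw (\<pi> p) (?A - dom p) (?A - ran p)"
        using c[OF p] by (subst bij_betw_cong[of _ _ "?c (dom p) (ran p)"]) (auto simp: \<pi>_def)
    qed auto
    moreover have "dom p \<union> (?A - dom p) = ?A" "ran p \<union> (?A - ran p) = ?A"
      using partial_isometriesD[OF p] by auto
    ultimately show ?thesis by simp
  qed
  have "\<pi> (q \<circ>\<^sub>m p) v = \<pi> q (\<pi> p v)"
    if p: "p \<in> partial_isometries X" and q: "q \<in> partial_isometries X" and dq: "dom q = ran p"
      and v: "v \<in> ?A" for p q v
  proof (cases "v \<in> dom p")
    case True
    then show ?thesis
      using map_comp_apply[OF dq] by (simp add: \<pi>_def dom_map_comp[OF dq] the_in_ran dq)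
  next
    case False
    then have "?c (dom p) (ran p) v \<in> ?A - ran p"
      using bij_betwE[OF c[OF p]] v by blast
    \<comment> \<open>\<open>inv_into\<close> cancels against \<open>h (ran p)\<close> only on the
      image of the latter. The complements of \<open>dom p\<close> and \<open>ran p\<close> have
      equal size, so both enumerations have the same image; this makes the completions
      telescope.\<close>
    moreover have "h (dom p) v \<in> h (ran p) ` (?A - ran p)"
    proof -
      have "card (?A - dom p) = card (?A - ran p)" using bij_betw_same_card[OF c[OF p]] .
      then show ?thesis using bij_betwE[OF h[of "dom p"]] h[of "ran p"] False v
        by (simp add: bij_betw_def)
    qed
    then have "h (ran p) (?c (dom p) (ran p) v) = h (dom p) v"
      by (rule f_inv_into_f)
    ultimately show ?thesis
      using False by (auto simp: \<pi>_def dom_map_comp[OF dq] ran_map_comp[OF dq] dq)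
  qed
  then have "coherent_action X ?A (\<lambda>x. x) \<pi>"
    unfolding coherent_action_def using \<pi> by (auto simp: \<pi>_def)
  then show ?thesis by blast
qed

section \<open>Walks in labelled graphs\<close>

text \<open>An edge may carry several labels, so the vertices do not determine the cost; hence a
  relation between the two.\<close>

inductive walk :: "('b \<Rightarrow> 'b \<Rightarrow> real \<Rightarrow> bool) \<Rightarrow> 'b list \<Rightarrow> real \<Rightarrow> bool"
  for E where
  single: "walk E [x] 0"
| step: "E x y s \<Longrightarrow> walk E (y # vs) c \<Longrightarrow> walk E (x # y # vs) (s + c)"

lemma walk_nonempty: "walk E vs c \<Longrightarrow> vs \<noteq> []"
  by (induction rule: walk.induct) auto

lemma walk_map:
  assumes "walk E vs c" "\<And>x y s. E x y s \<Longrightarrow> E' (f x) (f y) s"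
  shows "walk E' (map f vs) c"
  using assms by (induction rule: walk.induct) (auto intro: walk.intros)

lemma walk_nonneg:
  assumes "walk E vs c" "\<And>x y s. E x y s \<Longrightarrow> s \<ge> 0"
  shows "c \<ge> 0"
  using assms by (induction rule: walk.induct) auto

lemma walk_split:
  "walk E (us @ x # ws) c \<Longrightarrow>
    \<exists>c1 c2. walk E (us @ [x]) c1 \<and> walk E (x # ws) c2 \<and> c = c1 + c2"
proof (induction us arbitrary: c)
  case Nil
  then show ?case using walk.single[of E x] by (intro exI[of _ 0] exI[of _ c]) simp
next
  case (Cons u us)
  obtain y ys where y: "us @ x # ws = y # ys" by (cases us) auto
  with Cons.prems obtain s c' where s: "E u y s" "walk E (us @ x # ws) c'" "c = s + c'"
    by (auto elim: walk.cases)
  then obtain c1 c2 where c: "walk E (us @ [x]) c1" "walk E (x # ws) c2" "c' = c1 + c2"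
    using Cons.IH by blast
  obtain zs where "us @ [x] = y # zs" using y by (cases us) auto
  then have "walk E ((u # us) @ [x]) (s + c1)"
    using c(1) s(1) by (auto intro: walk.step)
  then show ?case using c s(3) by (metis add.assoc)
qed

lemma walk_join:
  "walk E (us @ [x]) c1 \<Longrightarrow> walk E (x # ws) c2 \<Longrightarrow> walk E (us @ x # ws) (c1 + c2)"
proof (induction us arbitrary: c1)
  case Nil
  then show ?case by (auto elim: walk.cases)
next
  case (Cons u us)
  obtain y ys where y: "us @ [x] = y # ys" by (cases us) auto
  with Cons.prems obtain s c' where s: "E u y s" "walk E (us @ [x]) c'" "c1 = s + c'"
    by (auto elim: walk.cases)
  then have "walk E (us @ x # ws) (c' + c2)" using Cons by blast
  moreover obtain zs where "us @ x # ws = y # zs" using y by (cases us) auto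
  ultimately have "walk E ((u # us) @ x # ws) (s + (c' + c2))"
    using s(1) by (auto intro: walk.step)
  then show ?case using s(3) by (simp add: add.assoc)
qed

lemma walk_rev:
  assumes "walk E vs c" "\<And>x y s. E x y s \<Longrightarrow> E y x s"
  shows "walk E (rev vs) c"
  using assms
proof (induction rule: walk.induct)
  case (single x)
  then show ?case by (auto intro: walk.intros)
next
  case (step x y s vs c)
  have "walk E [y, x] (s + 0)" using step by (blast intro: walk.intros)
  then have "walk E (rev vs @ y # [x]) (c + s)" using step walk_join[of E "rev vs" y c "[x]" s] by simp
  then show ?case by (simp add: add.commute)
qed

section \<open>Removing bad walks\<close>

text \<open>The invariant of the construction: a finite graph labelled by nonzero distances of
  \<open>X\<close> that contains a copy of \<open>X\<close> and on which the partial isometries act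
  coherently by automorphisms. Edges within the copy of \<open>X\<close> may carry further labels
  besides the true distance.\<close>

locale graph_witness =
  fixes X :: "'a metric" and V :: "'b set" and E :: "'b \<Rightarrow> 'b \<Rightarrow> real \<Rightarrow> bool"
    and e :: "'a \<Rightarrow> 'b" and \<Phi> :: "('a \<rightharpoonup> 'a) \<Rightarrow> 'b \<Rightarrow> 'b"
  assumes finite_X: "finite (mspace X)"
    and finite_V: "finite V"
    and edge_V: "E x y s \<Longrightarrow> x \<in> V \<and> y \<in> V"
    and edge_irrefl: "\<not> E x x s"
    and edge_label: "E x y s \<Longrightarrow> \<exists>a\<in>mspace X. \<exists>b\<in>mspace X. a \<noteq> b \<and> s = mdist X a b"
    and edge_sym: "E x y s \<Longrightarrow> E y x s"
    and e_V: "a \<in> mspace X \<Longrightarrow> e a \<in> V"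
    and e_edge: "a \<in> mspace X \<Longrightarrow> b \<in> mspace X \<Longrightarrow> a \<noteq> b \<Longrightarrow> E (e a) (e b) (mdist X a b)"
    and action: "coherent_action X V e \<Phi>"
    and action_edge: "p \<in> partial_isometries X \<Longrightarrow> E x y s \<Longrightarrow> E (\<Phi> p x) (\<Phi> p y) s"

text \<open>\<open>k\<close> bounds the number of edges, hence \<open>Suc k\<close> vertices. From
  \<open>k = 1\<close> on, walks of one edge are covered, which forces all labels of an edge to
  coincide.\<close>

definition no_bad_walks :: "nat \<Rightarrow> ('b \<Rightarrow> 'b \<Rightarrow> real \<Rightarrow> bool) \<Rightarrow> bool"
  where "no_bad_walks k E \<longleftrightarrow> (\<forall>vs c s. walk E vs c \<longrightarrow> length vs \<le> Suc k \<longrightarrow>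
    E (hd vs) (last vs) s \<longrightarrow> s \<le> c)"

lemma no_bad_walksD:
  "no_bad_walks k E \<Longrightarrow> walk E vs c \<Longrightarrow> length vs \<le> Suc k \<Longrightarrow> E (hd vs) (last vs) s \<Longrightarrow> s \<le> c"
  unfolding no_bad_walks_def by blast

context graph_witness
begin

lemma edge_pos: "E x y s \<Longrightarrow> s > 0"
  using edge_label[of x y s] Metric_space.mdist_pos_less[OF Metric_space_mspace_mdist, of _ _ X]
  by auto

lemma e_inj: "a \<in> mspace X \<Longrightarrow> b \<in> mspace X \<Longrightarrow> e a = e b \<Longrightarrow> a = b"
  using e_edge[of a b] edge_irrefl by metis

lemma walk_V: "walk E vs c \<Longrightarrow> length vs \<ge> 2 \<Longrightarrow> set vs \<subseteq> V"
proof (induction rule: walk.induct)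
  case (step x y s vs c)
  then show ?case using edge_V[OF step.hyps(1)] by (cases vs) auto
qed simp

end

section \<open>One removal step: bad walks with \<open>k + 1\<close> edges\<close>

locale graph_witness_step = graph_witness X V E e \<Phi>
  for X :: "'a metric" and V :: "'b set" and E e \<Phi> +
  fixes k :: nat
  assumes good: "no_bad_walks k E"
begin

text \<open>A vertex \<open>(x, S)\<close> carries one bit for every bad walk through \<open>x\<close>.  Edges preserve these bits, except
  that the long edge joining the ends of a bad walk flips the bit of that walk; the bits are then
  inconsistent along any lift of a bad walk.  The automorphism \<open>\<Phi>' p\<close> flips the bit of \<open>w\<close> precisely when
  this is forced by the requirement that it maps \<open>e' a\<close> to \<open>e' (p a)\<close>.\<close>

definition bad :: "('b list \<times> real) set"
  where "bad = {(vs, L). length vs = k + 2 \<and> E (hd vs) (last vs) L \<and> (\<exists>c<L. walk E vs c)}"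

definition flips :: "'b list \<times> real \<Rightarrow> 'b \<Rightarrow> 'b \<Rightarrow> real \<Rightarrow> bool"
  where "flips w x y s \<longleftrightarrow> s = snd w \<and> {x, y} = {hd (fst w), last (fst w)}"

definition V' :: "('b \<times> ('b list \<times> real) set) set"
  where "V' = {(x, S). x \<in> V \<and> S \<subseteq> {w \<in> bad. x \<in> set (fst w)}}"

definition E' :: "('b \<times> ('b list \<times> real) set) \<Rightarrow> ('b \<times> ('b list \<times> real) set) \<Rightarrow> real \<Rightarrow> bool"
  where "E' z z' s \<longleftrightarrow> z \<in> V' \<and> z' \<in> V' \<and> E (fst z) (fst z') s \<and>
    (\<forall>w\<in>bad. fst z \<in> set (fst w) \<longrightarrow> fst z' \<in> set (fst w) \<longrightarrow>
      (w \<in> snd z \<longleftrightarrow> w \<notin> snd z') = flips w (fst z) (fst z') s)"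

text \<open>Bits for the copy of \<open>X\<close>. If a bad walk joins two points of
  \<open>X\<close> and its offending label is their true distance, only the head receives the bit,
  so that the long edge flips it as \<open>E'\<close> demands. All other bits are zero.\<close>

definition \<kappa> :: "'a \<Rightarrow> ('b list \<times> real) set"
  where "\<kappa> a = {w \<in> bad. hd (fst w) = e a \<and>
    (\<exists>b\<in>mspace X. last (fst w) = e b \<and> mdist X a b = snd w)}"

definition e' :: "'a \<Rightarrow> 'b \<times> ('b list \<times> real) set"
  where "e' a = (e a, \<kappa> a)"

definition act :: "('a \<rightharpoonup> 'a) \<Rightarrow> 'b list \<times> real \<Rightarrow> 'b list \<times> real"
  where "act p w = (map (\<Phi> p) (fst w), snd w)"

definition twisted :: "('a \<rightharpoonup> 'a) \<Rightarrow> 'b list \<times> real \<Rightarrow> bool"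
  where "twisted p w \<longleftrightarrow> (\<exists>a\<in>dom p. e a \<in> set (fst w) \<and>
    (act p w \<in> \<kappa> (the (p a)) \<longleftrightarrow> w \<notin> \<kappa> a))"

definition \<Phi>' :: "('a \<rightharpoonup> 'a) \<Rightarrow> 'b \<times> ('b list \<times> real) set \<Rightarrow> 'b \<times> ('b list \<times> real) set"
  where "\<Phi>' p z = (\<Phi> p (fst z),
    act p ` {w \<in> bad. fst z \<in> set (fst w) \<and> (w \<in> snd z \<longleftrightarrow> \<not> twisted p w)})"

lemma badD:
  assumes "w \<in> bad"
  shows "E (hd (fst w)) (last (fst w)) (snd w)" "length (fst w) = k + 2" "set (fst w) \<subseteq> V"
    "hd (fst w) \<noteq> last (fst w)" "\<exists>c<snd w. walk E (fst w) c"
proof -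
  obtain vs L c where w: "w = (vs, L)" "length vs = k + 2" "E (hd vs) (last vs) L" "c < L" "walk E vs c"
    using assms by (auto simp: bad_def)
  then show "E (hd (fst w)) (last (fst w)) (snd w)" "length (fst w) = k + 2" "\<exists>c<snd w. walk E (fst w) c"
    by auto
  show "set (fst w) \<subseteq> V" using walk_V[OF w(5)] w by simp
  show "hd (fst w) \<noteq> last (fst w)" using w edge_irrefl by force
qed

lemma finite_bad: "finite bad"
proof -
  let ?L = "(\<lambda>(a, b). mdist X a b) ` (mspace X \<times> mspace X)"
  have "w \<in> {vs. set vs \<subseteq> V \<and> length vs = k + 2} \<times> ?L" if "w \<in> bad" for w
    using badD[OF that] edge_label[OF badD(1)[OF that]] by (cases w) auto
  then have "bad \<subseteq> {vs. set vs \<subseteq> V \<and> length vs = k + 2} \<times> ?L" by blast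
  moreover have "finite \<dots>"
    using finite_lists_length_eq[OF finite_V] finite_X by blast
  ultimately show ?thesis by (rule finite_subset)
qed

text \<open>A third point of \<open>X\<close> on a bad walk between points of \<open>X\<close> would, by the triangle inequality in
  \<open>X\<close>, split off a shorter bad walk.\<close>

lemma bad_third_point:
  assumes w: "w \<in> bad" and ab: "a \<in> mspace X" "b \<in> mspace X" "c \<in> mspace X"
    and ends: "hd (fst w) = e a" "last (fst w) = e b" "mdist X a b = snd w"
    and c: "e c \<in> set (fst w)"
  shows "c = a \<or> c = b"
proof (rule ccontr)
  assume neq: "\<not> (c = a \<or> c = b)"
  obtain us ws where vs: "fst w = us @ e c # ws" using c by (auto simp: in_set_conv_decomp)
  have us: "us \<noteq> []" "hd us = e a" using vs ends(1) neq e_inj[OF ab(3,1)] by (cases us; auto)+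
  have ws: "ws \<noteq> []" "last ws = e b" using vs ends(2) neq e_inj[OF ab(3,2)] by (cases ws rule: rev_cases; auto)+
  obtain l where l: "l < snd w" "walk E (fst w) l" using badD(5)[OF w] by blast
  then obtain l1 l2 where l12: "walk E (us @ [e c]) l1" "walk E (e c # ws) l2" "l = l1 + l2"
    using walk_split[of E us "e c" ws l] unfolding vs by auto
  \<comment> \<open>Neither end of the walk is \<open>e c\<close>, so both halves have at most
    \<open>k\<close> edges and \<open>good\<close> applies to each.\<close>
  have len: "length us + length ws = Suc k" using badD(2)[OF w] vs by simp
  have "mdist X a c \<le> l1"
    using no_bad_walksD[OF good l12(1), of "mdist X a c"] e_edge[OF ab(1,3)] neq len us ws
    by (cases ws) auto
  moreover have "mdist X c b \<le> l2"
    using no_bad_walksD[OF good l12(2), of "mdist X c b"] e_edge[OF ab(3,2)] neq len us ws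
    by (cases us) auto
  ultimately show False
    using mdist_triangle[OF ab(1,3,2)] l(1) l12(3) ends(3) by simp
qed

text \<open>This keeps the distances of \<open>X\<close> as edges between the lifted points. If
  \<open>a\<close> has the bit, then the walk starts at \<open>e a\<close> and ends in the copy of
  \<open>X\<close>; by \<open>bad_third_point\<close>, a point \<open>b\<close> of \<open>X\<close>
  on the walk without the bit is that end.\<close>

lemma \<kappa>_flips:
  assumes w: "w \<in> bad" and ab: "a \<in> mspace X" "b \<in> mspace X"
    and mem: "e a \<in> set (fst w)" "e b \<in> set (fst w)"
  shows "(w \<in> \<kappa> a \<longleftrightarrow> w \<notin> \<kappa> b) = flips w (e a) (e b) (mdist X a b)"
proof -
  have one: "hd (fst w) = e a \<and> last (fst w) = e b \<and> mdist X a b = snd w"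
    if a: "w \<in> \<kappa> a" and b: "w \<notin> \<kappa> b" and "a \<in> mspace X" "b \<in> mspace X" "e b \<in> set (fst w)" for a b
  proof -
    obtain c where c: "hd (fst w) = e a" "c \<in> mspace X" "last (fst w) = e c" "mdist X a c = snd w"
      using a by (auto simp: \<kappa>_def)
    then have "b = a \<or> b = c" using bad_third_point[OF w that(3) c(2) that(4)] that(5) by blast
    then show ?thesis using a b c by auto
  qed
  have two: "w \<in> \<kappa> a \<and> w \<notin> \<kappa> b"
    if "hd (fst w) = e a" "last (fst w) = e b" "mdist X a b = snd w" "b \<in> mspace X" for a b
    using that badD(4)[OF w] w by (auto simp: \<kappa>_def)
  have sym: "mdist X b a = mdist X a b"
    by (rule Metric_space.commute[OF Metric_space_mspace_mdist])
  show ?thesis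
  proof
    assume "w \<in> \<kappa> a \<longleftrightarrow> w \<notin> \<kappa> b"
    then show "flips w (e a) (e b) (mdist X a b)"
      using one[of a b] one[of b a] ab mem sym by (auto simp: flips_def)
  next
    assume "flips w (e a) (e b) (mdist X a b)"
    then show "w \<in> \<kappa> a \<longleftrightarrow> w \<notin> \<kappa> b"
      using two[of a b] two[of b a] ab sym by (auto simp: flips_def doubleton_eq_iff)
  qed
qed

context
  fixes p assumes p: "p \<in> partial_isometries X"
begin

lemma \<Phi>_inj: "x \<in> V \<Longrightarrow> y \<in> V \<Longrightarrow> \<Phi> p x = \<Phi> p y \<longleftrightarrow> x = y"
  using coherent_actionD(1)[OF action p] by (auto simp: bij_betw_def inj_on_def)

lemma act_bad: assumes w: "w \<in> bad" shows "act p w \<in> bad"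
proof -
  obtain c where c: "c < snd w" "walk E (fst w) c" using badD(5)[OF w] by blast
  have ne: "fst w \<noteq> []" using badD(2)[OF w] by auto
  have "walk E (map (\<Phi> p) (fst w)) c" using c(2) action_edge[OF p] by (rule walk_map)
  then show ?thesis
    using badD[OF w] action_edge[OF p badD(1)[OF w]] c ne
    by (auto simp: bad_def act_def hd_map last_map)
qed

lemma act_inj: "inj_on (act p) bad"
proof (rule inj_onI)
  fix w w' assume w: "w \<in> bad" "w' \<in> bad" and eq: "act p w = act p w'"
  have "inj_on (\<Phi> p) (set (fst w) \<union> set (fst w'))"
    using badD(3)[OF w(1)] badD(3)[OF w(2)] \<Phi>_inj by (meson Un_least inj_onI subsetD)
  then show "w = w'"
    using eq by (auto simp: act_def prod_eq_iff inj_on_map_eq_map)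
qed

lemma act_bij: "act p ` bad = bad"
  using act_bad endo_inj_surj[OF finite_bad _ act_inj] by blast

lemma mem_act: "w \<in> bad \<Longrightarrow> x \<in> V \<Longrightarrow> \<Phi> p x \<in> set (fst (act p w)) \<longleftrightarrow> x \<in> set (fst w)"
  using badD(3)[of w] \<Phi>_inj by (auto simp: act_def image_iff)

lemma flips_act:
  assumes "w \<in> bad" "x \<in> V" "y \<in> V"
  shows "flips (act p w) (\<Phi> p x) (\<Phi> p y) s = flips w x y s"
proof -
  have "fst w \<noteq> []" using badD(2)[OF assms(1)] by auto
  moreover from this have "hd (fst w) \<in> V" "last (fst w) \<in> V"
    using badD(3)[OF assms(1)] by auto
  ultimately show ?thesis
    using assms by (simp add: flips_def act_def hd_map last_map doubleton_eq_iff \<Phi>_inj)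
qed

text \<open>The witness in \<open>twisted\<close> does not matter: whether the bits of two points of
  \<open>dom p\<close> on \<open>w\<close> differ is decided by \<open>flips\<close>, which is
  invariant because \<open>p\<close> preserves distances.\<close>

lemma twisted_iff:
  assumes w: "w \<in> bad" and a: "a \<in> dom p" "e a \<in> set (fst w)"
  shows "twisted p w \<longleftrightarrow> (act p w \<in> \<kappa> (the (p a)) \<longleftrightarrow> w \<notin> \<kappa> a)"
proof -
  note P = partial_isometriesD[OF p]
  have "(act p w \<in> \<kappa> (the (p a)) \<longleftrightarrow> act p w \<notin> \<kappa> (the (p b))) = (w \<in> \<kappa> a \<longleftrightarrow> w \<notin> \<kappa> b)"
    if b: "b \<in> dom p" "e b \<in> set (fst w)" for b
  proof -
    have X: "a \<in> mspace X" "b \<in> mspace X" "the (p a) \<in> mspace X" "the (p b) \<in> mspace X"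
      using subsetD[OF P(2) a(1)] subsetD[OF P(2) b(1)] subsetD[OF P(3) the_in_ran[OF a(1)]]
        subsetD[OF P(3) the_in_ran[OF b(1)]] by auto
    have e: "e (the (p a)) = \<Phi> p (e a)" "e (the (p b)) = \<Phi> p (e b)"
      using coherent_actionD(3)[OF action p] a b by auto
    have "(act p w \<in> \<kappa> (the (p a)) \<longleftrightarrow> act p w \<notin> \<kappa> (the (p b)))
        = flips (act p w) (\<Phi> p (e a)) (\<Phi> p (e b)) (mdist X a b)"
      using \<kappa>_flips[OF act_bad[OF w] X(3,4)] mem_act[OF w e_V[OF X(1)]]
        mem_act[OF w e_V[OF X(2)]] P(4)[OF a(1) b(1)] a b by (simp add: e)
    also have "\<dots> = flips w (e a) (e b) (mdist X a b)"
      using flips_act[OF w e_V[OF X(1)] e_V[OF X(2)]] .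
    also have "\<dots> = (w \<in> \<kappa> a \<longleftrightarrow> w \<notin> \<kappa> b)"
      using \<kappa>_flips[OF w X(1,2) a(2) b(2)] by simp
    finally show ?thesis .
  qed
  then show ?thesis unfolding twisted_def using a by blast
qed

text \<open>Injectivity of \<open>act p\<close> turns the image in \<open>\<Phi>'\<close> into a
  rule for single bits: each travels with its walk and is reversed exactly when the walk is
  twisted.\<close>

lemma act_mem_\<Phi>':
  assumes w: "w \<in> bad" and x: "x \<in> set (fst w)"
  shows "act p w \<in> snd (\<Phi>' p (x, S)) \<longleftrightarrow> (w \<in> S \<longleftrightarrow> \<not> twisted p w)"
  using w x act_inj by (auto simp: \<Phi>'_def inj_on_def)

lemma \<Phi>'_V': "z \<in> V' \<Longrightarrow> \<Phi>' p z \<in> V'"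
  using coherent_actionD(2)[OF action p] act_bad mem_act by (fastforce simp: V'_def \<Phi>'_def)

lemma snd_\<Phi>': "snd (\<Phi>' p z) \<subseteq> bad"
  using act_bad by (auto simp: \<Phi>'_def)

end

lemma finite_V': "finite V'"
proof -
  have "V' \<subseteq> V \<times> Pow bad" by (auto simp: V'_def)
  then show ?thesis using finite_V finite_bad by (meson finite_Pow_iff finite_SigmaI finite_subset)
qed

lemma \<Phi>'_bij:
  assumes p: "p \<in> partial_isometries X"
  shows "bij_betw (\<Phi>' p) V' V'"
proof -
  have "inj_on (\<Phi>' p) V'"
  proof (rule inj_onI)
    fix z z' assume z: "z \<in> V'" "z' \<in> V'" and eq: "\<Phi>' p z = \<Phi>' p z'"
    obtain x S y T where xy: "z = (x, S)" "z' = (y, T)" by (cases z; cases z')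
    have V: "x \<in> V" "y \<in> V" and sub: "S \<subseteq> {w \<in> bad. x \<in> set (fst w)}" "T \<subseteq> {w \<in> bad. y \<in> set (fst w)}"
      using z xy by (auto simp: V'_def)
    have "x = y" using eq xy V \<Phi>_inj[OF p] by (auto simp: \<Phi>'_def)
    moreover have "w \<in> S \<longleftrightarrow> w \<in> T" if w: "w \<in> bad" "x \<in> set (fst w)" for w
      using act_mem_\<Phi>'[OF p w, of S] act_mem_\<Phi>'[OF p w, of T] eq xy \<open>x = y\<close> by auto
    ultimately show "z = z'" using sub xy by auto
  qed
  moreover have "\<Phi>' p ` V' \<subseteq> V'" using \<Phi>'_V'[OF p] by blast
  ultimately show ?thesis
    using endo_inj_surj[OF finite_V'] by (simp add: bij_betw_def)
qed

lemma act_comp: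
  assumes "p \<in> partial_isometries X" "q \<in> partial_isometries X" "dom q = ran p" "w \<in> bad"
  shows "act (q \<circ>\<^sub>m p) w = act q (act p w)"
  using badD(3)[OF assms(4)] coherent_actionD(4)[OF action assms(1-3)]
  by (auto simp: act_def)

text \<open>A cocycle identity: a point of \<open>dom p\<close> on \<open>w\<close> decides all
  three twists, and the intermediate bit cancels. If there is none, then
  \<open>dom q = ran p\<close> rules out a point of \<open>dom q\<close> on \<open>act p w\<close>,
  and no twist occurs.\<close>

lemma twisted_comp:
  assumes p: "p \<in> partial_isometries X" and q: "q \<in> partial_isometries X" and dq: "dom q = ran p"
    and w: "w \<in> bad"
  shows "twisted (q \<circ>\<^sub>m p) w \<longleftrightarrow> (twisted q (act p w) \<longleftrightarrow> \<not> twisted p w)"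
proof (cases "\<exists>a\<in>dom p. e a \<in> set (fst w)")
  case True
  then obtain a where a: "a \<in> dom p" "e a \<in> set (fst w)" by blast
  have X: "a \<in> mspace X" using a partial_isometriesD[OF p] by auto
  have "the (p a) \<in> dom q" using dq the_in_ran[OF a(1)] by simp
  moreover have "e (the (p a)) \<in> set (fst (act p w))"
    using coherent_actionD(3)[OF action p a(1)] mem_act[OF p w e_V[OF X]] a(2) by simp
  ultimately show ?thesis
    using twisted_iff[OF p w a] twisted_iff[OF q act_bad[OF p w], of "the (p a)"]
      twisted_iff[OF partial_isometry_map_comp[OF p q dq] w, of a] a
      act_comp[OF p q dq w] map_comp_apply[OF dq a(1)] dom_map_comp[OF dq]
    by (simp, blast)
next
  case False
  have "\<not> twisted p w" "\<not> twisted (q \<circ>\<^sub>m p) w"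
    using False by (auto simp: twisted_def dom_map_comp[OF dq] simp del: domIff)
  moreover have "\<not> twisted q (act p w)"
  proof
    assume "twisted q (act p w)"
    then obtain b where b: "b \<in> ran p" "e b \<in> set (fst (act p w))"
      using dq unfolding twisted_def by blast
    then obtain a where a: "a \<in> dom p" "b = the (p a)" by (force simp: ran_def)
    then have "a \<in> mspace X" using partial_isometriesD[OF p] by auto
    then have "e a \<in> set (fst w)"
      using b(2) a(2) mem_act[OF p w e_V] by (simp flip: coherent_actionD(3)[OF action p a(1)])
    with a False show False by blast
  qed
  ultimately show ?thesis by blast
qed

lemma \<Phi>'_comp:
  assumes p: "p \<in> partial_isometries X" and q: "q \<in> partial_isometries X" and dq: "dom q = ran p"
    and z: "z \<in> V'"
  shows "\<Phi>' (q \<circ>\<^sub>m p) z = \<Phi>' q (\<Phi>' p z)"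
proof -
  note qp = partial_isometry_map_comp[OF p q dq]
  obtain x S where xS: "z = (x, S)" by (cases z)
  have x: "x \<in> V" using z xS by (auto simp: V'_def)
  have fst: "fst (\<Phi>' (q \<circ>\<^sub>m p) z) = fst (\<Phi>' q (\<Phi>' p z))"
    using coherent_actionD(4)[OF action p q dq x] by (simp add: \<Phi>'_def xS)
  have "v \<in> snd (\<Phi>' (q \<circ>\<^sub>m p) z) \<longleftrightarrow> v \<in> snd (\<Phi>' q (\<Phi>' p z))" for v
  proof (cases "v \<in> bad")
    case True
    then obtain w where w: "w \<in> bad" "v = act (q \<circ>\<^sub>m p) w" using act_bij[OF qp] by blast
    then have v: "v = act q (act p w)" using act_comp[OF p q dq] by simp
    show ?thesis
    proof (cases "x \<in> set (fst w)")
      case True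
      then have "\<Phi> p x \<in> set (fst (act p w))" using mem_act[OF p w(1) x] by simp
      then have "v \<in> snd (\<Phi>' q (\<Phi>' p z)) \<longleftrightarrow> (act p w \<in> snd (\<Phi>' p z) \<longleftrightarrow> \<not> twisted q (act p w))"
        using act_mem_\<Phi>'[OF q act_bad[OF p w(1)], of "fst (\<Phi>' p z)" "snd (\<Phi>' p z)"] v
        by (simp add: \<Phi>'_def xS)
      then show ?thesis
        using act_mem_\<Phi>'[OF p w(1) True, of S] act_mem_\<Phi>'[OF qp w(1) True, of S]
          twisted_comp[OF p q dq w(1)] xS w(2) by auto
    next
      case False
      \<comment> \<open>Bits of walks that miss the vertex are absent on both sides, by the
        definition of \<open>V'\<close>.\<close>
      have "\<Phi>' (q \<circ>\<^sub>m p) z \<in> V'" "\<Phi>' q (\<Phi>' p z) \<in> V'"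
        using \<Phi>'_V' p q qp z by auto
      moreover have "fst (\<Phi>' (q \<circ>\<^sub>m p) z) \<notin> set (fst v)"
        using mem_act[OF qp w(1) x] False w(2) by (simp add: \<Phi>'_def xS)
      ultimately show ?thesis using fst by (auto simp: V'_def)
    qed
  next
    case False
    then show ?thesis using snd_\<Phi>'[OF qp, of z] snd_\<Phi>'[OF q, of "\<Phi>' p z"] by blast
  qed
  with fst show ?thesis by (metis prod_eqI subsetI subset_antisym)
qed

lemma e'_V':
  assumes "a \<in> mspace X"
  shows "e' a \<in> V'"
proof -
  have "hd (fst w) \<in> set (fst w)" if "w \<in> bad" for w
    using badD(2)[OF that] by (intro hd_in_set) auto
  then show ?thesis using assms by (force simp: V'_def e'_def e_V \<kappa>_def)
qed

lemma \<Phi>'_e':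
  assumes p: "p \<in> partial_isometries X" and a: "a \<in> dom p"
  shows "\<Phi>' p (e' a) = e' (the (p a))"
proof -
  have X: "a \<in> mspace X" "the (p a) \<in> mspace X"
    using partial_isometriesD[OF p] a the_in_ran[OF a] by auto
  have fst: "fst (\<Phi>' p (e' a)) = fst (e' (the (p a)))"
    using coherent_actionD(3)[OF action p a] by (simp add: e'_def \<Phi>'_def)
  have "v \<in> snd (\<Phi>' p (e' a)) \<longleftrightarrow> v \<in> snd (e' (the (p a)))" for v
  proof (cases "v \<in> bad")
    case True
    then obtain w where w: "w \<in> bad" "v = act p w" using act_bij[OF p] by blast
    show ?thesis
    proof (cases "e a \<in> set (fst w)")
      case True
      then show ?thesis
        using act_mem_\<Phi>'[OF p w(1) True, of "\<kappa> a"] twisted_iff[OF p w(1) a True] w(2)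
        by (auto simp: e'_def)
    next
      case False
      then have "fst (e' (the (p a))) \<notin> set (fst v)"
        using mem_act[OF p w(1) e_V[OF X(1)]] w(2) coherent_actionD(3)[OF action p a]
        by (simp add: e'_def)
      then show ?thesis
        using \<Phi>'_V'[OF p e'_V'[OF X(1)]] e'_V'[OF X(2)] fst by (auto simp: V'_def)
    qed
  next
    case False
    then show ?thesis using snd_\<Phi>'[OF p, of "e' a"] by (auto simp: e'_def \<kappa>_def)
  qed
  with fst show ?thesis by (metis prod_eqI subsetI subset_antisym)
qed

text \<open>The twist depends on the walk only, so it affects the bits at both ends of an edge alike
  and leaves their comparison unchanged.\<close>

lemma \<Phi>'_E':
  assumes p: "p \<in> partial_isometries X" and E: "E' z z' s"
  shows "E' (\<Phi>' p z) (\<Phi>' p z') s"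
proof -
  obtain x S y T where xy: "z = (x, S)" "z' = (y, T)" by (cases z; cases z')
  have V': "z \<in> V'" "z' \<in> V'" and Exy: "E x y s" using E xy by (auto simp: E'_def)
  then have V: "x \<in> V" "y \<in> V" using edge_V by auto
  have "(v \<in> snd (\<Phi>' p z) \<longleftrightarrow> v \<notin> snd (\<Phi>' p z')) = flips v (\<Phi> p x) (\<Phi> p y) s"
    if v: "v \<in> bad" and mem: "\<Phi> p x \<in> set (fst v)" "\<Phi> p y \<in> set (fst v)" for v
  proof -
    obtain w where w: "w \<in> bad" "v = act p w" using v act_bij[OF p] by blast
    have m: "x \<in> set (fst w)" "y \<in> set (fst w)" using mem mem_act[OF p w(1)] V w(2) by auto
    have "(w \<in> S \<longleftrightarrow> w \<notin> T) = flips w x y s" using E w(1) m xy by (auto simp: E'_def)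
    then show ?thesis
      using act_mem_\<Phi>'[OF p w(1) m(1), of S] act_mem_\<Phi>'[OF p w(1) m(2), of T]
        flips_act[OF p w(1) V] w(2) xy by auto
  qed
  moreover have "fst (\<Phi>' p z) = \<Phi> p x" "fst (\<Phi>' p z') = \<Phi> p y" by (simp_all add: \<Phi>'_def xy)
  ultimately show ?thesis
    unfolding E'_def using \<Phi>'_V'[OF p] V' action_edge[OF p Exy] by simp
qed

lemma graph_witness': "graph_witness X V' E' e' \<Phi>'"
proof
  show "E' (e' a) (e' b) (mdist X a b)" if "a \<in> mspace X" "b \<in> mspace X" "a \<noteq> b" for a b
    using that e'_V' e_edge \<kappa>_flips by (auto simp: E'_def e'_def)
  show "E' (\<Phi>' p z) (\<Phi>' p z') s" if "p \<in> partial_isometries X" "E' z z' s" for p z z' s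
    using that by (rule \<Phi>'_E')
  show "coherent_action X V' e' \<Phi>'"
    unfolding coherent_action_def using \<Phi>'_bij \<Phi>'_e' \<Phi>'_comp by blast
  have "flips w x y s = flips w y x s" for w x y s by (auto simp: flips_def)
  then show "E' y x s" if "E' x y s" for x y s
    using that edge_sym unfolding E'_def by blast
  show "\<exists>a\<in>mspace X. \<exists>b\<in>mspace X. a \<noteq> b \<and> s = mdist X a b" if "E' x y s" for x y s
    using edge_label[of "fst x" "fst y" s] that unfolding E'_def by blast
qed (auto simp: finite_X finite_V' e'_V' edge_irrefl E'_def)

text \<open>Only an edge carrying the largest label of a bad walk \<open>w\<close> flips the membership of \<open>w\<close>, and a
  walk of total cost below that label has no such edge.\<close>

lemma walk_mem_invariant:
  assumes "walk E' zs c" "w \<in> bad" "set (map fst zs) \<subseteq> set (fst w)" "c < snd w"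
  shows "w \<in> snd (hd zs) \<longleftrightarrow> w \<in> snd (last zs)"
  using assms
proof (induction rule: walk.induct)
  case (step z z' s zs c)
  have E: "E (fst z) (fst z') s" using step.hyps(1) by (auto simp: E'_def)
  have "c \<ge> 0"
    using walk_nonneg[OF step.hyps(2)] edge_pos by (force simp: E'_def)
  moreover have "s > 0" using edge_pos[OF E] .
  ultimately have "s \<noteq> snd w" "c < snd w" using step.prems by auto
  then have "w \<in> snd z \<longleftrightarrow> w \<in> snd z'"
    using step.hyps(1) step.prems unfolding E'_def flips_def by force
  then show ?case using step.IH step.prems \<open>c < snd w\<close> by simp
qed simp

text \<open>A bad walk of the new graph projects to one of the old graph, which by
  \<open>good\<close> must have exactly \<open>k + 1\<close> edges and so has a bit of its own. That
  bit is constant along the lifted walk, yet the edge joining its ends flips it.\<close>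

lemma no_bad_walks': "no_bad_walks (Suc k) E'"
  unfolding no_bad_walks_def
proof (intro allI impI, rule ccontr)
  fix zs c s
  assume walk: "walk E' zs c" and len: "length zs \<le> Suc (Suc k)" and edge: "E' (hd zs) (last zs) s"
    and "\<not> s \<le> c"
  have ne: "zs \<noteq> []" using walk_nonempty[OF walk] .
  let ?vs = "map fst zs"
  have wE: "walk E ?vs c" by (rule walk_map[OF walk]) (auto simp: E'_def)
  have eE: "E (hd ?vs) (last ?vs) s" using edge ne by (auto simp: E'_def hd_map last_map)
  show False
  proof (cases "length zs \<le> Suc k")
    case True
    then show ?thesis using good wE eE \<open>\<not> s \<le> c\<close> unfolding no_bad_walks_def by force
  next
    case False
    then have "length ?vs = k + 2" using len by simp
    then have w: "(?vs, s) \<in> bad"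
      using wE eE \<open>\<not> s \<le> c\<close> unfolding bad_def by (blast intro: not_le_imp_less)
    have "hd ?vs \<in> set ?vs" "last ?vs \<in> set ?vs" using ne by (auto intro: hd_in_set last_in_set simp del: set_map)
    then have "((?vs, s) \<in> snd (hd zs) \<longleftrightarrow> (?vs, s) \<notin> snd (last zs))"
      using edge w ne by (auto simp: E'_def flips_def hd_map last_map)
    then show False using walk_mem_invariant[OF walk w] \<open>\<not> s \<le> c\<close> by auto
  qed
qed

end

section \<open>Coherent extension of partial isometries of finite metric spaces\<close>

lemma coherent_action_transport:
  assumes \<Phi>: "coherent_action X V e \<Phi>" and g: "inj_on g V" and e: "\<And>a. a \<in> mspace X \<Longrightarrow> e a \<in> V"
    and e': "\<And>a. a \<in> mspace X \<Longrightarrow> e' a = g (e a)"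
  shows "coherent_action X (g ` V) e' (\<lambda>p x. g (\<Phi> p (inv_into V g x)))"
  unfolding coherent_action_def
proof (intro conjI ballI impI)
  let ?h = "inv_into V g"
  have hg: "?h (g x) = x" if "x \<in> V" for x using g that by simp
  fix p assume p: "p \<in> partial_isometries X"
  have "bij_betw (g \<circ> \<Phi> p \<circ> ?h) (g ` V) (g ` V)"
    using bij_betw_trans[OF bij_betw_inv_into[OF inj_on_imp_bij_betw[OF g]]
        bij_betw_trans[OF coherent_actionD(1)[OF \<Phi> p] inj_on_imp_bij_betw[OF g]]]
    by (simp add: comp_assoc)
  then show "bij_betw (\<lambda>x. g (\<Phi> p (?h x))) (g ` V) (g ` V)" by (simp add: comp_def)
  show "g (\<Phi> p (?h (e' a))) = e' (the (p a))" if a: "a \<in> dom p" for a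
  proof -
    have "a \<in> mspace X" "the (p a) \<in> mspace X"
      using partial_isometriesD(2,3)[OF p] a the_in_ran[OF a] by auto
    then show ?thesis using coherent_actionD(3)[OF \<Phi> p a] e by (simp add: e' hg)
  qed
  show "g (\<Phi> (q \<circ>\<^sub>m p) (?h v)) = g (\<Phi> q (?h (g (\<Phi> p (?h v)))))"
    if "q \<in> partial_isometries X" "dom q = ran p" "v \<in> g ` V" for q v
    using that coherent_actionD(2,4)[OF \<Phi> p] by (auto simp: hg)
qed

text \<open>The removal step changes the type of vertices. Renaming the finitely many vertices in a
  fixed type lets the steps be iterated by induction.\<close>

lemma graph_witness_transport:
  fixes V :: "'b set" and g :: "'b \<Rightarrow> 'c"
  assumes "graph_witness X V E e \<Phi>" "no_bad_walks k E" and g: "inj_on g V"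
  shows "\<exists>(V' :: 'c set) E' e' \<Phi>'. graph_witness X V' E' e' \<Phi>' \<and> no_bad_walks k E'"
proof -
  interpret graph_witness X V E e \<Phi> by fact
  let ?h = "inv_into V g"
  define E' where "E' x y s \<longleftrightarrow> x \<in> g ` V \<and> y \<in> g ` V \<and> E (?h x) (?h y) s" for x y s
  define \<Phi>' where "\<Phi>' p x = g (\<Phi> p (?h x))" for p x
  have hg: "?h (g x) = x" if "x \<in> V" for x using g that by simp
  have "graph_witness X (g ` V) E' (\<lambda>a. g (e a)) \<Phi>'"
  proof
    show "E' y x s" if "E' x y s" for x y s using that edge_sym by (auto simp: E'_def)
    show "\<exists>a\<in>mspace X. \<exists>b\<in>mspace X. a \<noteq> b \<and> s = mdist X a b" if "E' x y s" for x y s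
      using edge_label[of "?h x" "?h y" s] that by (auto simp: E'_def)
    show "E' (\<Phi>' p x) (\<Phi>' p y) s" if p: "p \<in> partial_isometries X" "E' x y s" for p x y s
      using that action_edge[OF p(1)] coherent_actionD(2)[OF action p(1)]
      by (auto simp: E'_def \<Phi>'_def hg)
    show "coherent_action X (g ` V) (\<lambda>a. g (e a)) \<Phi>'"
      unfolding \<Phi>'_def using action g e_V by (rule coherent_action_transport) auto
  qed (auto simp: finite_X finite_V e_V edge_irrefl e_edge hg E'_def)
  moreover have "no_bad_walks k E'"
    unfolding no_bad_walks_def
  proof (intro allI impI)
    fix vs c s
    assume w: "walk E' vs c" "length vs \<le> Suc k" "E' (hd vs) (last vs) s"
    have "walk E (map ?h vs) c" by (rule walk_map[OF w(1)]) (auto simp: E'_def)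
    then show "s \<le> c"
      using no_bad_walksD[OF \<open>no_bad_walks k E\<close>, of "map ?h vs" c s] w walk_nonempty[OF w(1)]
      by (auto simp: E'_def hd_map last_map)
  qed
  ultimately show ?thesis by blast
qed

text \<open>The initial graph carries every label on every edge, so that all permutations are automorphisms.\<close>

lemma graph_witness_exists:
  assumes X: "finite (mspace X)"
  shows "\<exists>(V :: nat set) E e \<Phi>. graph_witness X V E e \<Phi> \<and> no_bad_walks k E"
proof (induction k)
  case 0
  obtain \<pi> where \<pi>: "coherent_action X (mspace X) (\<lambda>x. x) \<pi>"
    using coherent_permutations[OF X] by blast
  define E where "E x y s \<longleftrightarrow> x \<in> mspace X \<and> y \<in> mspace X \<and> x \<noteq> y \<and>
    (\<exists>a\<in>mspace X. \<exists>b\<in>mspace X. a \<noteq> b \<and> s = mdist X a b)" for x y s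
  have "graph_witness X (mspace X) E (\<lambda>x. x) \<pi>"
  proof
    show "E (\<pi> p x) (\<pi> p y) s" if p: "p \<in> partial_isometries X" and E: "E x y s" for p x y s
    proof -
      have "\<pi> p x \<noteq> \<pi> p y"
        using coherent_actionD(1)[OF \<pi> p] E by (auto simp: E_def bij_betw_def inj_on_def)
      then show ?thesis using coherent_actionD(2)[OF \<pi> p] E by (auto simp: E_def)
    qed
  qed (use X \<pi> in \<open>auto simp: E_def\<close>)
  moreover have "no_bad_walks 0 E"
    unfolding no_bad_walks_def
  proof (intro allI impI)
    fix vs c s assume "walk E vs c" "length vs \<le> Suc 0" "E (hd vs) (last vs) s"
    then show "s \<le> c" using walk_nonempty[of E vs c] by (cases vs) (auto simp: E_def)
  qed
  moreover obtain g :: "'a \<Rightarrow> nat" where "inj_on g (mspace X)"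
    using finite_imp_inj_to_nat_seg[OF X] by blast
  ultimately show ?case by (rule graph_witness_transport)
next
  case (Suc k)
  then obtain V :: "nat set" and E e \<Phi> where "graph_witness X V E e \<Phi>" "no_bad_walks k E"
    by blast
  then interpret graph_witness_step X V E e \<Phi> k
    by (simp add: graph_witness_step_def graph_witness_step_axioms_def)
  obtain g :: "nat \<times> (nat list \<times> real) set \<Rightarrow> nat" where "inj_on g V'"
    using finite_imp_inj_to_nat_seg[OF finite_V'] by blast
  with graph_witness' no_bad_walks' show ?case by (rule graph_witness_transport)
qed

lemma finite_metric_bounds:
  assumes X: "finite (mspace X)"
  shows "\<exists>m l. 0 < m \<and> m \<le> l \<and>
    (\<forall>a\<in>mspace X. \<forall>b\<in>mspace X. a \<noteq> b \<longrightarrow> m \<le> mdist X a b \<and> mdist X a b \<le> l)"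
proof -
  \<comment> \<open>The element \<open>1\<close> keeps the set nonempty when \<open>X\<close> has no
    two distinct points.\<close>
  let ?L = "insert 1 ((\<lambda>(a, b). mdist X a b) ` {(a, b). a \<in> mspace X \<and> b \<in> mspace X \<and> a \<noteq> b})"
  have "finite {(a, b). a \<in> mspace X \<and> b \<in> mspace X \<and> a \<noteq> b}"
    by (rule finite_subset[of _ "mspace X \<times> mspace X"]) (use X in auto)
  then have fin: "finite ?L" by blast
  have "0 < Min ?L"
    using fin Metric_space.mdist_pos_less[OF Metric_space_mspace_mdist] by (subst Min_gr_iff) auto
  moreover have "Min ?L \<le> Max ?L" using fin by (intro Min_le Max_in) auto
  moreover have "Min ?L \<le> mdist X a b \<and> mdist X a b \<le> Max ?L"
    if "a \<in> mspace X" "b \<in> mspace X" "a \<noteq> b" for a b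
  proof -
    have "mdist X a b \<in> ?L" using that by force
    then show ?thesis using fin Min_le Max_ge by blast
  qed
  ultimately show ?thesis by blast
qed

text \<open>For \<open>k\<close> at least \<open>l / m\<close>, no walk with more than
  \<open>k\<close> edges is bad: each edge costs at least \<open>m\<close>, so the walk costs at
  least \<open>l\<close>, which bounds every label.\<close>

lemma graph_witness_no_bad_walks:
  assumes X: "finite (mspace X)"
  shows "\<exists>(V :: nat set) E e \<Phi>. graph_witness X V E e \<Phi> \<and>
    (\<forall>vs c s. walk E vs c \<longrightarrow> E (hd vs) (last vs) s \<longrightarrow> s \<le> c)"
proof -
  obtain m l where ml: "0 < m" "m \<le> l"
    "\<And>a b. a \<in> mspace X \<Longrightarrow> b \<in> mspace X \<Longrightarrow> a \<noteq> b \<Longrightarrow> m \<le> mdist X a b \<and> mdist X a b \<le> l"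
    using finite_metric_bounds[OF X] by blast
  obtain k :: nat where k: "l / m \<le> real k" using real_arch_simple by blast
  obtain V :: "nat set" and E e \<Phi> where W: "graph_witness X V E e \<Phi>" and no: "no_bad_walks k E"
    using graph_witness_exists[OF X] by blast
  interpret graph_witness X V E e \<Phi> by fact
  have L: "m \<le> s \<and> s \<le> l" if "E x y s" for x y s using edge_label[OF that] ml(3) by blast
  have long: "m * (real (length vs) - 1) \<le> c" if "walk E vs c" for vs c
    using that
  proof (induction rule: walk.induct)
    case (step x y s vs c)
    then show ?case using L[OF step.hyps(1)] by (simp add: algebra_simps)
  qed simp
  have "s \<le> c" if w: "walk E vs c" "E (hd vs) (last vs) s" for vs c s
  proof (cases "length vs \<le> Suc k")
    case True
    then show ?thesis using no_bad_walksD[OF no w(1)] w(2) by blast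
  next
    case False
    have "s \<le> l" using L[OF w(2)] by simp
    also have "\<dots> \<le> m * real k" using k ml(1) by (simp add: pos_divide_le_eq mult.commute)
    also have "\<dots> \<le> m * (real (length vs) - 1)" using False ml(1) by simp
    also have "\<dots> \<le> c" using long[OF w(1)] .
    finally show ?thesis .
  qed
  with W show ?thesis by blast
qed

section \<open>Path metrics of labelled graphs\<close>

locale path_graph =
  fixes V :: "'b set" and F :: "'b \<Rightarrow> 'b \<Rightarrow> real \<Rightarrow> bool" and m :: real
  assumes m_pos: "m > 0" and m_le: "\<And>x y s. F x y s \<Longrightarrow> m \<le> s"
    and F_sym: "\<And>x y s. F x y s \<Longrightarrow> F y x s"
    and F_connected: "\<And>x y. x \<in> V \<Longrightarrow> y \<in> V \<Longrightarrow> x \<noteq> y \<Longrightarrow> \<exists>s. F x y s"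
begin

definition costs :: "'b \<Rightarrow> 'b \<Rightarrow> real set"
  where "costs x y = {c. \<exists>vs. walk F vs c \<and> hd vs = x \<and> last vs = y}"

text \<open>\<open>Metric_space\<close> asks for nonnegativity and symmetry at all arguments; the
  value \<open>0\<close> off \<open>V\<close> provides both there.\<close>

definition path_dist :: "'b \<Rightarrow> 'b \<Rightarrow> real"
  where "path_dist x y = (if x \<in> V \<and> y \<in> V then Inf (costs x y) else 0)"

lemma walk_F_nonneg:
  assumes "walk F vs c"
  shows "0 \<le> c"
  using assms
proof (rule walk_nonneg)
  show "0 \<le> s" if "F x y s" for x y s using m_le[OF that] m_pos by simp
qed

lemma cost_nonneg: "c \<in> costs x y \<Longrightarrow> 0 \<le> c"
  using walk_F_nonneg by (auto simp: costs_def)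

lemma costs_nonempty:
  assumes "x \<in> V" "y \<in> V"
  shows "costs x y \<noteq> {}"
proof (cases "x = y")
  case True
  then show ?thesis using walk.single[of F x] unfolding costs_def by force
next
  case False
  then obtain s where "F x y s" using F_connected assms by blast
  then have "walk F [x, y] (s + 0)" by (intro walk.intros)
  then show ?thesis unfolding costs_def by force
qed

lemma path_dist_le:
  assumes "c \<in> costs x y" "x \<in> V" "y \<in> V"
  shows "path_dist x y \<le> c"
proof -
  have "bdd_below (costs x y)" using cost_nonneg by (intro bdd_belowI[of _ 0])
  then show ?thesis using assms by (simp add: path_dist_def cInf_lower)
qed

lemma path_dist_ge:
  assumes "\<And>c. c \<in> costs x y \<Longrightarrow> l \<le> c" "x \<in> V" "y \<in> V"
  shows "l \<le> path_dist x y"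
  using assms costs_nonempty by (auto simp: path_dist_def intro: cInf_greatest)

lemma costs_sym: "costs x y \<subseteq> costs y x"
proof
  fix c assume "c \<in> costs x y"
  then obtain vs where vs: "walk F vs c" "hd vs = x" "last vs = y" by (auto simp: costs_def)
  have "walk F (rev vs) c" using vs(1) F_sym by (rule walk_rev)
  then show "c \<in> costs y x" using vs unfolding costs_def by (auto simp: hd_rev last_rev)
qed

lemma costs_add:
  assumes "c \<in> costs x y" "c' \<in> costs y z"
  shows "c + c' \<in> costs x z"
proof -
  obtain us where us: "walk F us c" "hd us = x" "last us = y" using assms by (auto simp: costs_def)
  obtain vs where vs: "walk F vs c'" "hd vs = y" "last vs = z" using assms by (auto simp: costs_def)
  obtain us' where us': "us = us' @ [y]"
    using walk_nonempty[OF us(1)] us(3) by (metis append_butlast_last_id)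
  obtain vs' where vs': "vs = y # vs'"
    using walk_nonempty[OF vs(1)] vs(2) by (cases vs) auto
  have "walk F (us' @ y # vs') (c + c')" using us vs us' vs' by (auto intro: walk_join)
  moreover have "hd (us' @ y # vs') = x" "last (us' @ y # vs') = z"
    using us vs us' vs' by (auto simp: hd_append)
  ultimately show ?thesis unfolding costs_def by blast
qed

text \<open>A walk between distinct vertices has an edge. The uniform bound survives the infimum and
  makes the path distance positive.\<close>

lemma cost_ge: "c \<in> costs x y \<Longrightarrow> x \<noteq> y \<Longrightarrow> m \<le> c"
proof -
  assume "c \<in> costs x y" "x \<noteq> y"
  then obtain vs where "walk F vs c" "hd vs \<noteq> last vs" by (auto simp: costs_def)
  then show "m \<le> c"
  proof cases
    case (step u v s vs' c')
    have "c' \<ge> 0" using walk_F_nonneg[OF step(4)] .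
    then show ?thesis using m_le[OF step(3)] step(2) by simp
  qed simp
qed

lemma path_metric: "Metric_space V path_dist"
proof
  show nonneg: "0 \<le> path_dist x y" for x y
    using path_dist_ge[of x y 0] cost_nonneg by (cases "x \<in> V \<and> y \<in> V") (auto simp: path_dist_def)
  show "path_dist x y = path_dist y x" for x y
    using costs_sym[of x y] costs_sym[of y x] by (auto simp: path_dist_def)
  show "path_dist x y = 0 \<longleftrightarrow> x = y" if "x \<in> V" "y \<in> V" for x y
  proof
    assume "path_dist x y = 0"
    then show "x = y" using path_dist_ge[of x y m] cost_ge that m_pos by force
  next
    assume "x = y"
    moreover have "0 \<in> costs x x" using walk.single[of F x] unfolding costs_def by force
    ultimately show "path_dist x y = 0" using path_dist_le[of 0 x x] nonneg[of x x] that by simp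
  qed
  show "path_dist x z \<le> path_dist x y + path_dist y z" if V: "x \<in> V" "y \<in> V" "z \<in> V" for x y z
  proof -
    \<comment> \<open>The infima over the two walks are taken one at a time: first \<open>c\<close>
      varies with \<open>c'\<close> fixed, then \<open>c'\<close>.\<close>
    have "path_dist x z - c' \<le> path_dist x y" if c': "c' \<in> costs y z" for c'
    proof (rule path_dist_ge)
      fix c assume "c \<in> costs x y"
      then show "path_dist x z - c' \<le> c"
        using path_dist_le[OF costs_add[OF _ c']] V by fastforce
    qed (use V in auto)
    then have "path_dist x z - path_dist x y \<le> path_dist y z"
      using V by (intro path_dist_ge) (auto simp: algebra_simps)
    then show ?thesis by simp
  qed
qed

text \<open>Only an inequality, as \<open>f\<close> maps walks to walks; equality will come from
  applying it to an inverse as well.\<close>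

lemma path_dist_map:
  assumes f: "\<And>x y s. F x y s \<Longrightarrow> F (f x) (f y) s" and V: "x \<in> V" "y \<in> V" "f x \<in> V" "f y \<in> V"
  shows "path_dist (f x) (f y) \<le> path_dist x y"
proof (rule path_dist_ge)
  fix c assume "c \<in> costs x y"
  then obtain vs where vs: "walk F vs c" "hd vs = x" "last vs = y" by (auto simp: costs_def)
  have "walk F (map f vs) c" using vs(1) f by (rule walk_map)
  then have "c \<in> costs (f x) (f y)"
    using vs walk_nonempty[OF vs(1)] unfolding costs_def by (auto simp: hd_map last_map intro!: exI[of _ "map f vs"])
  then show "path_dist (f x) (f y) \<le> c" using V by (intro path_dist_le)
qed (use V in auto)

end

definition isometric_action :: "'a metric \<Rightarrow> 'b metric \<Rightarrow> (('a \<rightharpoonup> 'a) \<Rightarrow> 'b \<Rightarrow> 'b) \<Rightarrow> bool"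
  where "isometric_action X Y \<Phi> \<longleftrightarrow> (\<forall>p\<in>partial_isometries X. \<forall>x\<in>mspace Y. \<forall>y\<in>mspace Y.
    mdist Y (\<Phi> p x) (\<Phi> p y) = mdist Y x y)"

text \<open>The graph without bad walks is completed by edges of length \<open>l\<close>, an upper
  bound of all distances, and given its path metric. Between points of \<open>X\<close>, a walk with
  an added edge costs at least \<open>l\<close>, and any other walk is not bad; so no walk is
  shorter than the distance in \<open>X\<close>.\<close>

theorem coherent_extension:
  fixes X :: "'a metric"
  assumes X: "finite (mspace X)"
  shows "\<exists>(Y :: nat metric) e \<Phi>. finite (mspace Y) \<and> e ` mspace X \<subseteq> mspace Y \<and>
    (\<forall>a\<in>mspace X. \<forall>b\<in>mspace X. mdist Y (e a) (e b) = mdist X a b) \<and>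
    coherent_action X (mspace Y) e \<Phi> \<and> isometric_action X Y \<Phi>"
proof -
  obtain m l where ml: "0 < m" "m \<le> l"
    "\<And>a b. a \<in> mspace X \<Longrightarrow> b \<in> mspace X \<Longrightarrow> a \<noteq> b \<Longrightarrow> m \<le> mdist X a b \<and> mdist X a b \<le> l"
    using finite_metric_bounds[OF X] by blast
  obtain V :: "nat set" and E e \<Phi> where W: "graph_witness X V E e \<Phi>"
    and no: "\<And>vs c s. walk E vs c \<Longrightarrow> E (hd vs) (last vs) s \<Longrightarrow> s \<le> c"
    using graph_witness_no_bad_walks[OF X] by blast
  interpret graph_witness X V E e \<Phi> by fact
  define F where "F x y s \<longleftrightarrow> x \<in> V \<and> y \<in> V \<and> x \<noteq> y \<and> (E x y s \<or> s = l)" for x y s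
  have E_F: "F x y s" if "E x y s" for x y s
    using that edge_V[OF that] edge_irrefl by (auto simp: F_def)
  interpret path_graph V F m
  proof
    show "m \<le> s" if "F x y s" for x y s
      using that edge_label[of x y s] ml by (auto simp: F_def)
  qed (use ml edge_sym in \<open>auto simp: F_def\<close>)
  have E_walk: "l \<le> c \<or> walk E vs c" if "walk F vs c" for vs c
    using that
  proof (induction rule: walk.induct)
    case (step x y s vs c)
    have "c \<ge> 0" using walk_F_nonneg[OF step.hyps(2)] .
    moreover have "s \<ge> 0" using m_le[OF step.hyps(1)] m_pos by simp
    ultimately show ?case using step by (auto simp: F_def intro: walk.step)
  qed (auto intro: walk.single)
  define Y where "Y = metric (V, path_dist)"
  have Y: "mspace Y = V" "mdist Y = path_dist"
    unfolding Y_def using Metric_space.mspace_metric[OF path_metric] Metric_space.mdist_metric[OF path_metric]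
    by auto
  have "mdist Y (e a) (e b) = mdist X a b" if ab: "a \<in> mspace X" "b \<in> mspace X" for a b
  proof (cases "a = b")
    case True
    then show ?thesis using ab e_V Y by (metis mdist_zero)
  next
    case False
    note edge = e_edge[OF ab False]
    have "walk F [e a, e b] (mdist X a b + 0)"
      using E_F[OF edge] by (intro walk.intros)
    then have "mdist X a b \<in> costs (e a) (e b)" unfolding costs_def by force
    then have "path_dist (e a) (e b) \<le> mdist X a b"
      using e_V ab by (intro path_dist_le)
    moreover have "mdist X a b \<le> path_dist (e a) (e b)"
    proof (rule path_dist_ge)
      fix c assume "c \<in> costs (e a) (e b)"
      then obtain vs where vs: "walk F vs c" "hd vs = e a" "last vs = e b" by (auto simp: costs_def)
      show "mdist X a b \<le> c"
        using E_walk[OF vs(1)] no[of vs c "mdist X a b"] vs edge ml(3)[OF ab False] by auto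
    qed (use e_V ab in auto)
    ultimately show ?thesis by (simp add: Y)
  qed
  moreover have "isometric_action X Y \<Phi>"
    unfolding isometric_action_def Y
  proof (intro ballI)
    fix p x y assume p: "p \<in> partial_isometries X" and V: "x \<in> V" "y \<in> V"
    have le: "path_dist (\<Phi> q u) (\<Phi> q v) \<le> path_dist u v"
      if q: "q \<in> partial_isometries X" and uv: "u \<in> V" "v \<in> V" for q u v
    proof -
      have "F (\<Phi> q z) (\<Phi> q z') s" if "F z z' s" for z z' s
        using that action_edge[OF q] coherent_actionD(1,2)[OF action q]
        by (auto simp: F_def bij_betw_def inj_on_def)
      then show ?thesis
        using uv coherent_actionD(2)[OF action q] by (intro path_dist_map)
    qed
    \<comment> \<open>\<open>\<Phi> (pinv p)\<close> undoes \<open>\<Phi> p\<close> on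
      \<open>V\<close>, so \<open>le\<close> also gives the other direction.\<close>
    have "path_dist x y \<le> path_dist (\<Phi> p x) (\<Phi> p y)"
      using le[OF pinv_partial_isometries[OF p], of "\<Phi> p x" "\<Phi> p y"] V
        coherent_actionD(2)[OF action p] coherent_action_pinv[OF action p] by simp
    then show "path_dist (\<Phi> p x) (\<Phi> p y) = path_dist x y" using le[OF p V] by simp
  qed
  ultimately show ?thesis
    using finite_V e_V action by (intro exI[of _ Y] exI[of _ e] exI[of _ \<Phi>]) (auto simp: Y)
qed

section \<open>Amalgamation\<close>

text \<open>The free amalgam: points on different sides have as distance the shortest detour
  \<open>r\<close> through \<open>Z\<close>. As \<open>Z\<close> is finite and nonempty the minimum
  is attained, which keeps distinct points apart.\<close>

lemma metric_amalgam:
  fixes M N :: "'a metric"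
  assumes Z: "mspace M \<inter> mspace N = Z" "finite Z" "Z \<noteq> {}"
    and agree: "\<And>x y. x \<in> Z \<Longrightarrow> y \<in> Z \<Longrightarrow> mdist M x y = mdist N x y"
  shows "\<exists>L. mspace L = mspace M \<union> mspace N \<and> metric_extends L M \<and> metric_extends L N"
proof -
  let ?M = "mspace M" and ?N = "mspace N"
  define r where "r x y = Min ((\<lambda>z. mdist M x z + mdist N z y) ` Z)" for x y
  have M: "mdist M x y = mdist M y x" "0 \<le> mdist M x y" for x y
    using Metric_space.commute[OF Metric_space_mspace_mdist] Metric_space.nonneg[OF Metric_space_mspace_mdist] by auto
  have N: "mdist N x y = mdist N y x" "0 \<le> mdist N x y" for x y
    using Metric_space.commute[OF Metric_space_mspace_mdist] Metric_space.nonneg[OF Metric_space_mspace_mdist] by auto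
  have ZM: "z \<in> ?M" "z \<in> ?N" if "z \<in> Z" for z using that Z(1) by auto
  have r_le: "r x y \<le> mdist M x z + mdist N z y" if "z \<in> Z" for x y z
    unfolding r_def using Z that by (intro Min_le) auto
  have r_attained: "\<exists>z\<in>Z. r x y = mdist M x z + mdist N z y" for x y
  proof -
    have "r x y \<in> (\<lambda>z. mdist M x z + mdist N z y) ` Z"
      unfolding r_def using Z(2,3) by (intro Min_in) auto
    then show ?thesis by blast
  qed
  \<comment> \<open>The mixed triangle inequalities. In \<open>r1\<close> and \<open>r2\<close> the
    side to be bounded is a detour. In \<open>r3\<close> and \<open>r4\<close> it joins two points
    lying opposite to the third, and \<open>agree\<close> converts the piece between the two points
    of \<open>Z\<close>.\<close>
  have r1: "r x y \<le> mdist M x x' + r x' y" if "x \<in> ?M" "x' \<in> ?M" for x x' y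
  proof -
    obtain z where z: "z \<in> Z" "r x' y = mdist M x' z + mdist N z y" using r_attained by blast
    then show ?thesis using r_le[OF z(1), of x y] mdist_triangle[of x M x' z] ZM[OF z(1)] that by simp
  qed
  have r2: "r x y \<le> r x y' + mdist N y' y" if "y \<in> ?N" "y' \<in> ?N" for x y y'
  proof -
    obtain z where z: "z \<in> Z" "r x y' = mdist M x z + mdist N z y'" using r_attained by blast
    then show ?thesis using r_le[OF z(1), of x y] mdist_triangle[of z N y' y] ZM[OF z(1)] that by simp
  qed
  have r3: "mdist M x x' \<le> r x y + r x' y" if "x \<in> ?M" "x' \<in> ?M" "y \<in> ?N" for x x' y
  proof -
    obtain z where z: "z \<in> Z" "r x y = mdist M x z + mdist N z y" using r_attained by blast
    obtain z' where z': "z' \<in> Z" "r x' y = mdist M x' z' + mdist N z' y" using r_attained by blast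
    show ?thesis
      using mdist_triangle[of x M z x'] mdist_triangle[of z M z' x'] mdist_triangle[of z N y z']
        z z' ZM[OF z(1)] ZM[OF z'(1)] that agree[OF z(1) z'(1)] M(1)[of x' z'] N(1)[of z' y]
      by simp
  qed
  have r4: "mdist N y y' \<le> r x y + r x y'" if "x \<in> ?M" "y \<in> ?N" "y' \<in> ?N" for x y y'
  proof -
    obtain z where z: "z \<in> Z" "r x y = mdist M x z + mdist N z y" using r_attained by blast
    obtain z' where z': "z' \<in> Z" "r x y' = mdist M x z' + mdist N z' y'" using r_attained by blast
    show ?thesis
      using mdist_triangle[of y N z y'] mdist_triangle[of z N z' y'] mdist_triangle[of z M x z']
        z z' ZM[OF z(1)] ZM[OF z'(1)] that agree[OF z(1) z'(1)] M(1)[of x z] N(1)[of z y]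
      by simp
  qed
  have r_N: "r z y = mdist N z y" if "z \<in> Z" "y \<in> ?N" for z y
  proof -
    obtain w where w: "w \<in> Z" "r z y = mdist M z w + mdist N w y" using r_attained by blast
    then have "mdist N z y \<le> r z y"
      using mdist_triangle[of z N w y] agree[OF that(1) w(1)] ZM[OF w(1)] ZM[OF that(1)] that by simp
    moreover have "mdist M z z = 0" using ZM[OF that(1)] by simp
    ultimately show ?thesis using r_le[OF that(1), of z y] by simp
  qed
  have r_M: "r x z = mdist M x z" if "z \<in> Z" "x \<in> ?M" for x z
  proof -
    obtain w where w: "w \<in> Z" "r x z = mdist M x w + mdist N w z" using r_attained by blast
    then have "mdist M x z \<le> r x z"
      using mdist_triangle[of x M w z] agree[OF w(1) that(1)] ZM[OF w(1)] ZM[OF that(1)] that by simp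
    moreover have "mdist N z z = 0" using ZM[OF that(1)] by simp
    ultimately show ?thesis using r_le[OF that(1), of x z] by simp
  qed
  have r_pos: "r x y > 0" if "x \<in> ?M" "y \<in> ?N" "x \<noteq> y" for x y
  proof -
    obtain z where z: "z \<in> Z" "r x y = mdist M x z + mdist N z y" using r_attained by blast
    have "mdist M x z \<noteq> 0 \<or> mdist N z y \<noteq> 0"
      using that ZM[OF z(1)] by (metis mdist_zero)
    then show ?thesis using z M(2)[of x z] N(2)[of z y] by linarith
  qed
  \<comment> \<open>The cases overlap on \<open>Z\<close>; \<open>d_N\<close> and
    \<open>d_MN\<close> show that their order is immaterial.\<close>
  define d where "d x y = (if x \<in> ?M \<and> y \<in> ?M then mdist M x y
    else if x \<in> ?N \<and> y \<in> ?N then mdist N x y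
    else if x \<in> ?M \<and> y \<in> ?N then r x y
    else if x \<in> ?N \<and> y \<in> ?M then r y x else 0)" for x y
  have d_M: "d x y = mdist M x y" if "x \<in> ?M" "y \<in> ?M" for x y
    using that by (simp add: d_def)
  have d_N: "d x y = mdist N x y" if "x \<in> ?N" "y \<in> ?N" for x y
    using that agree[of x y] Z(1) by (auto simp: d_def)
  have d_MN: "d x y = r x y" if "x \<in> ?M" "y \<in> ?N" for x y
  proof -
    have "x \<in> ?N \<Longrightarrow> x \<in> Z" "y \<in> ?M \<Longrightarrow> y \<in> Z" using that Z(1) by auto
    then show ?thesis using that r_N[of x y] r_M[of y x] by (auto simp: d_def)
  qed
  have d_sym: "d x y = d y x" for x y
    using M(1)[of x y] N(1)[of x y]
    by (cases "x \<in> ?M"; cases "y \<in> ?M"; cases "x \<in> ?N"; cases "y \<in> ?N") (simp_all add: d_def)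
  have "Metric_space (?M \<union> ?N) d"
  proof
    have r_nonneg: "0 \<le> r x y" for x y
      using r_attained[of x y] M(2) N(2) by (metis add_nonneg_nonneg)
    show "0 \<le> d x y" for x y by (simp add: d_def M(2) N(2) r_nonneg)
    show "d x y = d y x" for x y by (rule d_sym)
    show "d x y = 0 \<longleftrightarrow> x = y" if "x \<in> ?M \<union> ?N" "y \<in> ?M \<union> ?N" for x y
    proof (cases "x \<in> ?M \<and> y \<in> ?M \<or> x \<in> ?N \<and> y \<in> ?N")
      case True
      then show ?thesis using d_M d_N by auto
    next
      case False
      then consider "x \<in> ?M" "y \<in> ?N" "x \<noteq> y" | "y \<in> ?M" "x \<in> ?N" "y \<noteq> x" using \<open>x \<in> _\<close> \<open>y \<in> _\<close> by blast
      then show ?thesis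
      proof cases
        case 1
        then show ?thesis using r_pos[of x y] d_MN[of x y] by simp
      next
        case 2
        then show ?thesis using r_pos[of y x] d_MN[of y x] d_sym[of x y] by simp
      qed
    qed
    fix x y z assume "x \<in> ?M \<union> ?N" "y \<in> ?M \<union> ?N" "z \<in> ?M \<union> ?N"
    then consider "x \<in> ?M" "y \<in> ?M" "z \<in> ?M" | "x \<in> ?M" "y \<in> ?M" "z \<in> ?N"
      | "x \<in> ?M" "y \<in> ?N" "z \<in> ?M" | "x \<in> ?M" "y \<in> ?N" "z \<in> ?N"
      | "x \<in> ?N" "y \<in> ?M" "z \<in> ?M" | "x \<in> ?N" "y \<in> ?M" "z \<in> ?N"
      | "x \<in> ?N" "y \<in> ?N" "z \<in> ?M" | "x \<in> ?N" "y \<in> ?N" "z \<in> ?N"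
      by blast
    then show "d x z \<le> d x y + d y z"
    proof cases
      case 1
      then show ?thesis using mdist_triangle[of x M y z] by (simp add: d_M)
    next
      case 2
      then show ?thesis using r1[of x y z] by (simp add: d_M d_MN)
    next
      case 3
      then show ?thesis using r3[of x z y] by (simp add: d_M d_MN d_sym[of y z])
    next
      case 4
      then show ?thesis using r2[of z y x] by (simp add: d_N d_MN)
    next
      case 5
      then show ?thesis using r1[of z y x] M(1)[of y z]
        by (simp add: d_M d_MN d_sym[of x])
    next
      case 6
      then show ?thesis using r4[of y x z] by (simp add: d_N d_MN d_sym[of x y])
    next
      case 7
      then show ?thesis using r2[of x y z] N(1)[of x y] by (simp add: d_N d_MN d_sym[of _ z])
    next
      case 8
      then show ?thesis using mdist_triangle[of x N y z] by (simp add: d_N)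
    qed
  qed
  then have "mspace (metric (?M \<union> ?N, d)) = ?M \<union> ?N" "mdist (metric (?M \<union> ?N, d)) = d"
    by (auto simp: Metric_space.mspace_metric Metric_space.mdist_metric)
  then show ?thesis
    using d_M d_N by (intro exI[of _ "metric (?M \<union> ?N, d)"]) (auto simp: metric_extends_def)
qed

section \<open>Extensions realized inside a given set of points\<close>

lemma metric_transport:
  assumes g: "inj_on g (mspace Y)"
  defines "N \<equiv> metric (g ` mspace Y, \<lambda>u v. mdist Y (inv_into (mspace Y) g u) (inv_into (mspace Y) g v))"
  shows "mspace N = g ` mspace Y"
    and "x \<in> mspace Y \<Longrightarrow> y \<in> mspace Y \<Longrightarrow> mdist N (g x) (g y) = mdist Y x y"
proof -
  have "Metric_space (g ` mspace Y) (\<lambda>u v. mdist Y (inv_into (mspace Y) g u) (inv_into (mspace Y) g v))"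
  proof
    fix x y z assume "x \<in> g ` mspace Y" "y \<in> g ` mspace Y" "z \<in> g ` mspace Y"
    then show "mdist Y (inv_into (mspace Y) g x) (inv_into (mspace Y) g z)
      \<le> mdist Y (inv_into (mspace Y) g x) (inv_into (mspace Y) g y)
        + mdist Y (inv_into (mspace Y) g y) (inv_into (mspace Y) g z)"
      by (intro mdist_triangle inv_into_into)
  next
    fix x y assume "x \<in> g ` mspace Y" "y \<in> g ` mspace Y"
    then show "mdist Y (inv_into (mspace Y) g x) (inv_into (mspace Y) g y) = 0 \<longleftrightarrow> x = y"
      using g by (auto simp: inv_into_f_f inj_on_eq_iff)
  qed (auto intro: Metric_space.commute[OF Metric_space_mspace_mdist]
      Metric_space.nonneg[OF Metric_space_mspace_mdist])
  then show "mspace N = g ` mspace Y"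
    and "x \<in> mspace Y \<Longrightarrow> y \<in> mspace Y \<Longrightarrow> mdist N (g x) (g y) = mdist Y x y"
    using g by (auto simp: N_def Metric_space.mspace_metric Metric_space.mdist_metric)
qed

text \<open>The witness \<open>W\<close> is a finite part of \<open>U\<close> with the inclusion as
  embedding, so the property persists when \<open>U\<close> is enlarged. This lets a chain of
  extensions accumulate it.\<close>

definition coherently_extensible_at :: "'a metric \<Rightarrow> 'a set \<Rightarrow> bool"
  where "coherently_extensible_at U Z \<longleftrightarrow> (\<exists>W \<Phi>. finite W \<and> Z \<subseteq> W \<and> W \<subseteq> mspace U \<and>
    coherent_action (submetric U Z) W (\<lambda>x. x) \<Phi> \<and>
    isometric_action (submetric U Z) (submetric U W) \<Phi>)"

lemma partial_isometries_mono:
  assumes "mspace X \<subseteq> mspace Y" "\<And>x y. x \<in> mspace X \<Longrightarrow> y \<in> mspace X \<Longrightarrow> mdist X x y = mdist Y x y"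
  shows "partial_isometries X \<subseteq> partial_isometries Y"
proof
  fix p assume p: "p \<in> partial_isometries X"
  have "mdist Y (the (p x)) (the (p y)) = mdist Y x y" if xy: "x \<in> dom p" "y \<in> dom p" for x y
  proof -
    have "x \<in> mspace X" "y \<in> mspace X" "the (p x) \<in> mspace X" "the (p y) \<in> mspace X"
      using subsetD[OF partial_isometriesD(2)[OF p]] subsetD[OF partial_isometriesD(3)[OF p]]
        xy the_in_ran[OF xy(1)] the_in_ran[OF xy(2)] by blast+
    then show ?thesis using partial_isometriesD(4)[OF p xy] assms(2) by simp
  qed
  then show "p \<in> partial_isometries Y"
    using partial_isometriesD(1-3)[OF p] assms(1) by (auto simp: partial_isometries_def)
qed

lemma partial_isometries_cong:
  assumes "mspace X = mspace Y" "\<And>x y. x \<in> mspace X \<Longrightarrow> y \<in> mspace X \<Longrightarrow> mdist X x y = mdist Y x y"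
  shows "partial_isometries X = partial_isometries Y"
  using partial_isometries_mono[of X Y] partial_isometries_mono[of Y X] assms by (simp add: subset_antisym)

lemma coherently_extensible_at_mono:
  assumes ext: "metric_extends U' U" and U: "coherently_extensible_at U Z"
  shows "coherently_extensible_at U' Z"
proof -
  obtain W \<Phi> where W: "finite W" "Z \<subseteq> W" "W \<subseteq> mspace U"
    and \<Phi>: "coherent_action (submetric U Z) W (\<lambda>x. x) \<Phi>"
      "isometric_action (submetric U Z) (submetric U W) \<Phi>"
    using U unfolding coherently_extensible_at_def by blast
  have W': "W \<subseteq> mspace U'" and d: "\<And>x y. x \<in> W \<Longrightarrow> y \<in> W \<Longrightarrow> mdist U' x y = mdist U x y"
    using ext W(3) by (auto simp: metric_extends_def)
  have P: "partial_isometries (submetric U' Z) = partial_isometries (submetric U Z)"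
  proof (rule partial_isometries_cong)
    show "mspace (submetric U' Z) = mspace (submetric U Z)" using W W' by auto
    show "mdist (submetric U' Z) x y = mdist (submetric U Z) x y"
      if "x \<in> mspace (submetric U' Z)" "y \<in> mspace (submetric U' Z)" for x y
      using that W(2) d by auto
  qed
  have "coherent_action (submetric U' Z) W (\<lambda>x. x) \<Phi>"
    using \<Phi>(1) unfolding coherent_action_def P .
  moreover have "isometric_action (submetric U' Z) (submetric U' W) \<Phi>"
    using \<Phi>(2) W(3) W' d coherent_actionD(2)[OF \<Phi>(1)]
    unfolding isometric_action_def P by (simp add: Int_absorb2)
  ultimately show ?thesis unfolding coherently_extensible_at_def using W W' by blast
qed

lemma inj_on_into_infinite:
  assumes "finite A" "infinite B"
  shows "\<exists>h. inj_on h A \<and> h ` A \<subseteq> B"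
proof -
  obtain B' where "B' \<subseteq> B" "finite B'" "card B' = card A"
    using infinite_arbitrarily_large[OF assms(2)] by blast
  moreover from this obtain h where "bij_betw h A B'"
    using finite_same_card_bij[OF assms(1)] by metis
  ultimately show ?thesis by (auto simp: bij_betw_def)
qed

lemma coherent_extension_step:
  fixes M :: "'a metric"
  assumes C: "mspace M \<subseteq> C" "infinite (C - mspace M)" and Z: "finite Z" "Z \<subseteq> mspace M"
  shows "\<exists>M'. metric_extends M' M \<and> mspace M' \<subseteq> C \<and> finite (mspace M' - mspace M) \<and>
    coherently_extensible_at M' Z"
\<comment> \<open>Amalgamation needs a nonempty common part; for empty \<open>Z\<close> the empty
  \<open>W\<close> will do.\<close>
proof (cases "Z = {}")
  case True
  have "dom p = {}" if "p \<in> partial_isometries (submetric M {})" for p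
    using partial_isometriesD(2)[OF that] by simp
  then have "coherent_action (submetric M {}) {} (\<lambda>x. x) \<Phi>" for \<Phi>
    unfolding coherent_action_def by (auto simp: bij_betw_def simp del: dom_eq_empty_conv)
  then have "coherently_extensible_at M Z"
    unfolding coherently_extensible_at_def True
    by (intro exI[of _ "{}"] exI[of _ undefined]) (auto simp: isometric_action_def)
  then show ?thesis using C by (intro exI[of _ M]) (auto simp: metric_extends_def)
next
  case False
  have Zs: "mspace (submetric M Z) = Z" using Z by auto
  obtain Y :: "nat metric" and e \<Phi> where Y: "finite (mspace Y)" "e ` Z \<subseteq> mspace Y"
    and e: "\<And>a b. a \<in> Z \<Longrightarrow> b \<in> Z \<Longrightarrow> mdist Y (e a) (e b) = mdist M a b"
    and \<Phi>: "coherent_action (submetric M Z) (mspace Y) e \<Phi>" "isometric_action (submetric M Z) Y \<Phi>"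
    using coherent_extension[of "submetric M Z"] Z(1) unfolding Zs by auto
  have e_inj: "inj_on e Z"
  proof (rule inj_onI)
    fix a b assume ab: "a \<in> Z" "b \<in> Z" "e a = e b"
    then have "mdist M a b = 0" using e[OF ab(1,2)] Y(2) by (metis image_subset_iff mdist_zero)
    then show "a = b" using ab Z by (metis mdist_zero subsetD)
  qed
  obtain h where h: "inj_on h (mspace Y - e ` Z)" "h ` (mspace Y - e ` Z) \<subseteq> C - mspace M"
    using inj_on_into_infinite[of "mspace Y - e ` Z" "C - mspace M"] Y(1) C(2) by auto
  define g where "g y = (if y \<in> e ` Z then inv_into Z e y else h y)" for y
  have ge: "g (e z) = z" if "z \<in> Z" for z using that e_inj by (simp add: g_def)
  have gh: "g y = h y" "h y \<notin> mspace M" "h y \<in> C" if "y \<in> mspace Y - e ` Z" for y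
    using that h(2) by (auto simp: g_def)
  have "inj_on g (e ` Z \<union> (mspace Y - e ` Z))"
    unfolding inj_on_Un
  proof (intro conjI)
    show "inj_on g (e ` Z)" using ge by (auto intro!: inj_onI)
    show "inj_on g (mspace Y - e ` Z)" using h(1) gh(1) inj_on_cong[of "mspace Y - e ` Z" g h] by blast
    show "g ` (e ` Z - (mspace Y - e ` Z)) \<inter> g ` (mspace Y - e ` Z - e ` Z) = {}"
      using ge gh Z(2) by auto
  qed
  then have g: "inj_on g (mspace Y)" using Y(2) by (simp add: Un_absorb1)
  have gY: "g ` mspace Y \<inter> mspace M = Z" "g ` mspace Y \<subseteq> C"
  proof -
    have "g y \<in> Z \<or> g y \<in> C - mspace M" if "y \<in> mspace Y" for y
      using that ge gh[of y] by (cases "y \<in> e ` Z") auto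
    moreover have "Z \<subseteq> g ` mspace Y" using ge Y(2) by force
    ultimately show "g ` mspace Y \<inter> mspace M = Z" "g ` mspace Y \<subseteq> C" using Z(2) C(1) by blast+
  qed
  define N where "N = metric (g ` mspace Y,
    \<lambda>u v. mdist Y (inv_into (mspace Y) g u) (inv_into (mspace Y) g v))"
  have N: "mspace N = g ` mspace Y"
    "\<And>x y. x \<in> mspace Y \<Longrightarrow> y \<in> mspace Y \<Longrightarrow> mdist N (g x) (g y) = mdist Y x y"
    unfolding N_def using metric_transport[OF g] by auto
  have "mdist M x y = mdist N x y" if "x \<in> Z" "y \<in> Z" for x y
  proof -
    have "e x \<in> mspace Y" "e y \<in> mspace Y" using that Y(2) by auto
    then show ?thesis using N(2)[of "e x" "e y"] e[OF that] ge that by simp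
  qed
  then obtain L where L: "mspace L = mspace M \<union> mspace N" "metric_extends L M" "metric_extends L N"
    using metric_amalgam[of M N Z] gY(1) Z(1) False unfolding N(1) by blast
  let ?W = "mspace N" and ?\<Psi> = "\<lambda>p x. g (\<Phi> p (inv_into (mspace Y) g x))"
  have P: "partial_isometries (submetric L Z) = partial_isometries (submetric M Z)"
  proof (rule partial_isometries_cong)
    show "mspace (submetric L Z) = mspace (submetric M Z)" using L(1) Z(2) by auto
    show "mdist (submetric L Z) x y = mdist (submetric M Z) x y"
      if "x \<in> mspace (submetric L Z)" "y \<in> mspace (submetric L Z)" for x y
      using that L(2) Z(2) by (auto simp: metric_extends_def)
  qed
  have "coherent_action (submetric M Z) (g ` mspace Y) (\<lambda>x. x) ?\<Psi>"
    by (rule coherent_action_transport[OF \<Phi>(1) g]) (use Y(2) ge in \<open>auto simp: Zs\<close>)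
  then have "coherent_action (submetric L Z) ?W (\<lambda>x. x) ?\<Psi>"
    unfolding N(1) coherent_action_def P .
  moreover have "isometric_action (submetric L Z) (submetric L ?W) ?\<Psi>"
  proof -
    have d: "mdist L (g x) (g y) = mdist Y x y" if "x \<in> mspace Y" "y \<in> mspace Y" for x y
      using L(3) N that by (auto simp: metric_extends_def)
    have "mdist L (?\<Psi> p (g x)) (?\<Psi> p (g y)) = mdist L (g x) (g y)"
      if "p \<in> partial_isometries (submetric M Z)" "x \<in> mspace Y" "y \<in> mspace Y" for p x y
      using that g coherent_actionD(2)[OF \<Phi>(1)] \<Phi>(2) by (simp add: d isometric_action_def)
    then show ?thesis
      unfolding isometric_action_def P using N(1) by (auto simp del: inv_into_f_f)
  qed
  moreover have "finite ?W" "Z \<subseteq> ?W" "?W \<subseteq> mspace L"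
    using L(1) Y(1) gY(1) N(1) by auto
  ultimately have "coherently_extensible_at L Z"
    unfolding coherently_extensible_at_def by (intro exI conjI)
  moreover have "finite (mspace L - mspace M)"
    by (rule finite_subset[of _ "mspace N"]) (use L(1) N(1) Y(1) in auto)
  moreover have "mspace L \<subseteq> C" using L(1) N(1) C(1) gY(2) by auto
  ultimately show ?thesis using L(2) by blast
qed

section \<open>Unions of chains\<close>

lemma metric_extends_trans: "metric_extends L N \<Longrightarrow> metric_extends N M \<Longrightarrow> metric_extends L M"
  by (auto simp: metric_extends_def subset_iff)

lemma metric_chain_union:
  fixes M :: "nat \<Rightarrow> 'a metric"
  assumes ext: "\<And>n. metric_extends (M (Suc n)) (M n)"
  shows "\<exists>U. mspace U = (\<Union>n. mspace (M n)) \<and> (\<forall>n. metric_extends U (M n))"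
proof -
  have le: "metric_extends (M n) (M k)" if "k \<le> n" for k n
    using that
  proof (induction n rule: dec_induct)
    case base
    then show ?case by (simp add: metric_extends_def)
  next
    case (step n)
    then show ?case using ext metric_extends_trans by blast
  qed
  let ?U = "\<Union>n. mspace (M n)"
  \<comment> \<open>The distance is read off at the first stage that contains both points; any other
    such stage gives the same value.\<close>
  define d where "d x y = (if x \<in> ?U \<and> y \<in> ?U
    then mdist (M (LEAST n. x \<in> mspace (M n) \<and> y \<in> mspace (M n))) x y else 0)" for x y
  have d: "d x y = mdist (M n) x y" if "x \<in> mspace (M n)" "y \<in> mspace (M n)" for x y n
  proof -
    let ?k = "LEAST n. x \<in> mspace (M n) \<and> y \<in> mspace (M n)"
    have "x \<in> mspace (M ?k) \<and> y \<in> mspace (M ?k)" "?k \<le> n"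
      using LeastI[of "\<lambda>n. x \<in> mspace (M n) \<and> y \<in> mspace (M n)" n] that by (auto intro: Least_le)
    then have "mdist (M n) x y = mdist (M ?k) x y" using le by (simp add: metric_extends_def)
    then show ?thesis using that by (auto simp: d_def)
  qed
  have common: "\<exists>n. F \<subseteq> mspace (M n)" if "finite F" "F \<subseteq> ?U" for F
    using that
  proof (induction F rule: finite_induct)
    case (insert x F)
    then obtain n k where "F \<subseteq> mspace (M n)" "x \<in> mspace (M k)" by auto
    moreover have "mspace (M n) \<subseteq> mspace (M (max n k))" "mspace (M k) \<subseteq> mspace (M (max n k))"
      using le[of n "max n k"] le[of k "max n k"] by (auto simp: metric_extends_def)
    ultimately show ?case by (intro exI[of _ "max n k"]) auto
  qed simp
  have "Metric_space ?U d"
  proof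
    show "0 \<le> d x y" for x y
      using Metric_space.nonneg[OF Metric_space_mspace_mdist] by (auto simp: d_def)
    show "d x y = d y x" for x y
      using Metric_space.commute[OF Metric_space_mspace_mdist] by (auto simp: d_def conj_commute)
    show "d x y = 0 \<longleftrightarrow> x = y" if "x \<in> ?U" "y \<in> ?U" for x y
    proof -
      have "\<exists>n. {x, y} \<subseteq> mspace (M n)" by (rule common) (use that in simp_all)
      then obtain n where "{x, y} \<subseteq> mspace (M n)" ..
      then show ?thesis using d[of x n y] by simp
    qed
    show "d x z \<le> d x y + d y z" if "x \<in> ?U" "y \<in> ?U" "z \<in> ?U" for x y z
    proof -
      have "\<exists>n. {x, y, z} \<subseteq> mspace (M n)" by (rule common) (use that in simp_all)
      then obtain n where "{x, y, z} \<subseteq> mspace (M n)" ..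
      then show ?thesis using d[of x n y] d[of y n z] d[of x n z] mdist_triangle[of x "M n" y z] by simp
    qed
  qed
  then have U: "mspace (metric (?U, d)) = ?U" "mdist (metric (?U, d)) = d"
    by (auto simp: Metric_space.mspace_metric Metric_space.mdist_metric)
  then have "metric_extends (metric (?U, d)) (M n)" for n
    using d by (auto simp: metric_extends_def)
  with U(1) show ?thesis by blast
qed

theorem coherently_extensible_extension:
  fixes M :: "'a metric"
  assumes C: "countable C" "mspace M \<subseteq> C" "infinite (C - mspace M)"
  shows "\<exists>U. metric_extends U M \<and> mspace U \<subseteq> C \<and>
    (\<forall>Z. finite Z \<longrightarrow> Z \<subseteq> mspace U \<longrightarrow> coherently_extensible_at U Z)"
proof -
  let ?\<F> = "{Z. finite Z \<and> Z \<subseteq> C}"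
  have F: "countable ?\<F>" using C(1) by (rule countable_Collect_finite_subset)
  \<comment> \<open>The second component of the decoded pair is ignored, so each finite subset of
    \<open>C\<close> recurs arbitrarily late, in particular after all its points have
    appeared.\<close>
  define Q where "Q n = from_nat_into ?\<F> (fst (prod_decode n))" for n
  have Q: "Q n \<in> ?\<F>" for n unfolding Q_def by (intro from_nat_into) auto
  have "\<exists>f. \<forall>n. (mspace (f n) \<subseteq> C \<and> infinite (C - mspace (f n)) \<and> (n = 0 \<longrightarrow> f n = M)) \<and>
    (metric_extends (f (Suc n)) (f n) \<and>
      (Q n \<subseteq> mspace (f n) \<longrightarrow> coherently_extensible_at (f (Suc n)) (Q n)))"
  proof (rule dependent_nat_choice)
    show "\<exists>N. mspace N \<subseteq> C \<and> infinite (C - mspace N) \<and> ((0 :: nat) = 0 \<longrightarrow> N = M)"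
      using C by blast
    fix N and n :: nat assume N: "mspace N \<subseteq> C \<and> infinite (C - mspace N) \<and> (n = 0 \<longrightarrow> N = M)"
    show "\<exists>N'. (mspace N' \<subseteq> C \<and> infinite (C - mspace N') \<and> (Suc n = 0 \<longrightarrow> N' = M)) \<and>
      (metric_extends N' N \<and> (Q n \<subseteq> mspace N \<longrightarrow> coherently_extensible_at N' (Q n)))"
    proof (cases "Q n \<subseteq> mspace N")
      case True
      then obtain N' where N': "metric_extends N' N" "mspace N' \<subseteq> C" "finite (mspace N' - mspace N)"
        "coherently_extensible_at N' (Q n)"
        using coherent_extension_step[of N C "Q n"] N Q[of n] by auto
      have "C - mspace N \<subseteq> (C - mspace N') \<union> (mspace N' - mspace N)" by blast
      then have "infinite (C - mspace N')" using N N'(3) by (meson finite_Un finite_subset)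
      then show ?thesis using N' by blast
    next
      case False
      then show ?thesis using N by (intro exI[of _ N]) (auto simp: metric_extends_def)
    qed
  qed
  then obtain f where f: "\<And>n. mspace (f n) \<subseteq> C" "f 0 = M" "\<And>n. metric_extends (f (Suc n)) (f n)"
    "\<And>n. Q n \<subseteq> mspace (f n) \<Longrightarrow> coherently_extensible_at (f (Suc n)) (Q n)"
    by metis
  obtain U where U: "mspace U = (\<Union>n. mspace (f n))" "\<And>n. metric_extends U (f n)"
    using metric_chain_union[of f] f(3) by blast
  have mono: "mspace (f k) \<subseteq> mspace (f n)" if "k \<le> n" for k n
    using that
  proof (induction n rule: dec_induct)
    case (step n)
    then show ?case using f(3)[of n] by (auto simp: metric_extends_def)
  qed simp
  have "coherently_extensible_at U Z" if Z: "finite Z" "Z \<subseteq> mspace U" for Z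
  proof -
    have "\<exists>k. Z \<subseteq> mspace (f k)"
      using Z
    proof (induction Z rule: finite_induct)
      case (insert x Z)
      then obtain n k where "Z \<subseteq> mspace (f n)" "x \<in> mspace (f k)" using U(1) by auto
      then show ?case using mono[of n "max n k"] mono[of k "max n k"] by (intro exI[of _ "max n k"]) auto
    qed simp
    then obtain k where k: "Z \<subseteq> mspace (f k)" by blast
    then have "Z \<in> ?\<F>" using Z(1) f(1) by blast
    then have "Q (prod_encode (to_nat_on ?\<F> Z, k)) = Z"
      using F by (simp add: Q_def from_nat_into_to_nat_on)
    moreover have "Z \<subseteq> mspace (f (prod_encode (to_nat_on ?\<F> Z, k)))"
      using k mono[OF le_prod_encode_2] by blast
    ultimately have "coherently_extensible_at (f (Suc (prod_encode (to_nat_on ?\<F> Z, k)))) Z"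
      using f(4) by metis
    then show ?thesis using U(2) coherently_extensible_at_mono by blast
  qed
  moreover have "mspace U \<subseteq> C" using U(1) f(1) by blast
  moreover have "metric_extends U M" using U(2)[of 0] f(2) by simp
  ultimately show ?thesis by blast
qed

section \<open>From coherent extensibility to ultraextensivity\<close>

lemma partial_isometries_submetric_mono:
  assumes "A \<subseteq> B"
  shows "partial_isometries (submetric U A) \<subseteq> partial_isometries (submetric U B)"
  using assms by (intro partial_isometries_mono) auto

text \<open>Back-and-forth with a single kind of step: the extension of \<open>p\<close> to a finite
  \<open>W\<close> permutes \<open>W\<close>, so a given point enters domain and range at
  once.\<close>

lemma ultrahomogeneous_if_coherently_extensible:
  assumes count: "countable (mspace U)"
    and U: "\<And>Z. finite Z \<Longrightarrow> Z \<subseteq> mspace U \<Longrightarrow> coherently_extensible_at U Z"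
  shows "ultrahomogeneous U"
  unfolding ultrahomogeneous_def
proof
  fix p assume p: "p \<in> partial_isometries U"
  have extend: "\<exists>q\<in>partial_isometries U. p \<subseteq>\<^sub>m q \<and> (u \<in> mspace U \<longrightarrow> u \<in> dom q \<and> u \<in> ran q)"
    if p: "p \<in> partial_isometries U" for p u
  proof -
    let ?Z = "dom p \<union> ran p \<union> (if u \<in> mspace U then {u} else {})"
    have Z: "finite ?Z" "?Z \<subseteq> mspace U"
      using partial_isometriesD(1-3)[OF p] by (auto simp: finite_ran)
    obtain W \<Phi> where W: "finite W" "?Z \<subseteq> W" "W \<subseteq> mspace U"
      and \<Phi>: "coherent_action (submetric U ?Z) W (\<lambda>x. x) \<Phi>"
        "isometric_action (submetric U ?Z) (submetric U W) \<Phi>"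
      using U[OF Z] unfolding coherently_extensible_at_def by blast
    have pZ: "p \<in> partial_isometries (submetric U ?Z)"
      using p Z(2) unfolding partial_isometries_def by auto
    define q where "q x = (if x \<in> W then Some (\<Phi> p x) else None)" for x
    have bij: "bij_betw (\<Phi> p) W W" using coherent_actionD(1)[OF \<Phi>(1) pZ] .
    have "ran q = \<Phi> p ` W" by (auto simp: q_def ran_def image_iff)
    then have q: "dom q = W" "ran q = W"
      using bij by (auto simp: q_def dom_def bij_betw_def split: if_splits)
    have "mdist U (\<Phi> p x) (\<Phi> p y) = mdist U x y" if "x \<in> W" "y \<in> W" for x y
      using \<Phi>(2) pZ that W(3) unfolding isometric_action_def by auto
    then have "q \<in> partial_isometries U"
      using W unfolding partial_isometries_def q by (simp add: q q_def)
    moreover have "p \<subseteq>\<^sub>m q"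
      using coherent_actionD(3)[OF \<Phi>(1) pZ] W(2) by (force simp: map_le_def q_def)
    ultimately show ?thesis using q W(2) by auto
  qed
  \<comment> \<open>If \<open>U\<close> is empty, the enumeration has arbitrary values, hence the
    guard \<open>u n \<in> mspace U\<close> below.\<close>
  define u where "u = from_nat_into (mspace U)"
  have "\<exists>f. \<forall>n. (f n \<in> partial_isometries U \<and> (n = 0 \<longrightarrow> f n = p)) \<and>
    (f n \<subseteq>\<^sub>m f (Suc n) \<and> (u n \<in> mspace U \<longrightarrow> u n \<in> dom (f (Suc n)) \<and> u n \<in> ran (f (Suc n))))"
    by (rule dependent_nat_choice) (use p extend in \<open>blast+\<close>)
  then obtain f where f: "\<And>n. f n \<in> partial_isometries U" "f 0 = p" "\<And>n. f n \<subseteq>\<^sub>m f (Suc n)"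
    "\<And>n. u n \<in> mspace U \<Longrightarrow> u n \<in> dom (f (Suc n)) \<and> u n \<in> ran (f (Suc n))"
    by metis
  have mono: "f k \<subseteq>\<^sub>m f n" if "k \<le> n" for k n
    using that by (induction n rule: dec_induct) (auto intro: map_le_trans f(3))
  have all: "\<exists>n. x \<in> dom (f n) \<and> x \<in> ran (f n)" if "x \<in> mspace U" for x
  proof -
    have "u (to_nat_on (mspace U) x) = x"
      using count that by (simp add: u_def from_nat_into_to_nat_on)
    then show ?thesis using f(4)[of "to_nat_on (mspace U) x"] that by auto
  qed
  \<comment> \<open>The union of the chain of partial isometries, made extensional as
    \<open>Isom\<close> requires.\<close>
  define F where "F = (\<lambda>x\<in>mspace U. the (f (LEAST n. x \<in> dom (f n)) x))"
  have F: "f n x = Some (F x)" if "x \<in> dom (f n)" for x n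
  proof -
    let ?k = "LEAST n. x \<in> dom (f n)"
    have k: "x \<in> dom (f ?k)" using that by (rule LeastI)
    moreover have "f ?k \<subseteq>\<^sub>m f n" using that by (intro mono Least_le)
    ultimately have "f n x = f ?k x" by (simp add: map_le_def)
    moreover have "x \<in> mspace U" using partial_isometriesD(2)[OF f(1)] that by blast
    ultimately show ?thesis using k by (simp add: F_def domIff)
  qed
  have iso: "F x \<in> mspace U \<and> F y \<in> mspace U \<and> mdist U (F x) (F y) = mdist U x y"
    if xy: "x \<in> mspace U" "y \<in> mspace U" for x y
  proof -
    obtain k l where kl: "x \<in> dom (f k)" "y \<in> dom (f l)" using all xy by blast
    then have d: "x \<in> dom (f (max k l))" "y \<in> dom (f (max k l))"
      using map_le_implies_dom_le[OF mono[of k "max k l"]] map_le_implies_dom_le[OF mono[of l "max k l"]] by auto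
    have "F x \<in> ran (f (max k l))" "F y \<in> ran (f (max k l))"
      using F d by (auto intro: ranI)
    then show ?thesis
      using partial_isometriesD(3,4)[OF f(1)[of "max k l"]] d F[OF d(1)] F[OF d(2)] by fastforce
  qed
  have "inj_on F (mspace U)"
    by (rule inj_onI) (metis iso mdist_zero)
  moreover have "F ` mspace U = mspace U"
  proof
    show "F ` mspace U \<subseteq> mspace U" using iso by blast
    show "mspace U \<subseteq> F ` mspace U"
    proof
      fix y assume "y \<in> mspace U"
      then obtain n x where "f n x = Some y" using all[of y] by (auto simp: ran_def)
      then show "y \<in> F ` mspace U"
        using F[of x n] partial_isometriesD(2)[OF f(1), of n] by (metis domI image_eqI option.inject subsetD)
    qed
  qed
  ultimately have "F \<in> Isom U"
    using iso by (simp add: Isom_def Bij_def bij_betw_def F_def)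
  moreover have "extends_partial F p"
    using F[of _ 0] f(2) by (auto simp: extends_partial_def)
  ultimately show "\<exists>f\<in>Isom U. extends_partial f p" by blast
qed

section \<open>Words and isometry groups of S-extensions\<close>

lemma Isom_groupD:
  assumes "f \<in> Isom Y"
  shows "bij_betw f (mspace Y) (mspace Y)" "f \<in> extensional (mspace Y)"
    "\<And>x. x \<in> mspace Y \<Longrightarrow> f x \<in> mspace Y"
    "\<And>x y. x \<in> mspace Y \<Longrightarrow> y \<in> mspace Y \<Longrightarrow> mdist Y (f x) (f y) = mdist Y x y"
  using assms by (auto simp: Isom_def Bij_def dest: bij_betwE)

lemma carrier_Isom_group: "carrier (Isom_group Y) = Isom Y"
  by (simp add: Isom_group_def)

lemma one_Isom_group: "\<one>\<^bsub>Isom_group Y\<^esub> = (\<lambda>x\<in>mspace Y. x)"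
  by (simp add: Isom_group_def BijGroup_def)

lemma mult_Isom_group:
  "f \<in> Isom Y \<Longrightarrow> g \<in> Isom Y \<Longrightarrow> f \<otimes>\<^bsub>Isom_group Y\<^esub> g = compose (mspace Y) f g"
  by (auto simp: Isom_group_def BijGroup_def Isom_def)

lemma restrict_Isom:
  assumes "bij_betw f (mspace Y) (mspace Y)"
    and "\<And>x y. x \<in> mspace Y \<Longrightarrow> y \<in> mspace Y \<Longrightarrow> mdist Y (f x) (f y) = mdist Y x y"
  shows "restrict f (mspace Y) \<in> Isom Y"
  using assms by (auto simp: Isom_def Bij_def bij_betw_def inj_on_def)

context
  fixes X Y :: "'a metric" and \<phi>
  assumes S: "S_extension X Y \<phi>"
begin

interpretation G: group "Isom_group Y" by (rule group_Isom_group)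

lemma S_extensionD:
  assumes "p \<in> nonid_partial_isometries X"
  shows "\<phi> p \<in> Isom Y" "extends_partial (\<phi> p) p" "\<phi> (pinv p) = inv\<^bsub>Isom_group Y\<^esub> (\<phi> p)"
  using S assms by (auto simp: S_extension_def)

lemma word_value_Isom:
  assumes "w \<in> lists (nonid_partial_isometries X)"
  shows "word_value (Isom_group Y) \<phi> w \<in> Isom Y"
proof -
  have "word_value (Isom_group Y) \<phi> w \<in> carrier (Isom_group Y)"
    using G.is_group S_extensionD assms
    by (intro word_value_closed[where i = pinv]) (auto simp: carrier_Isom_group)
  then show ?thesis by (simp add: carrier_Isom_group)
qed

text \<open>Removes the quotient: elements of the image group can be handled as values of
  words.\<close>

lemma free_lift_range:
  "free_lift (Isom_group Y) \<phi> ` carrier (FP X)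
    = word_value (Isom_group Y) \<phi> ` lists (nonid_partial_isometries X)"
proof -
  have *: "free_lift (Isom_group Y) \<phi> (word_eq (nonid_partial_isometries X) pinv `` {w})
      = word_value (Isom_group Y) \<phi> w" if "w \<in> lists (nonid_partial_isometries X)" for w
    using G.is_group S_extensionD that
    by (intro free_lift_class) (auto simp: carrier_Isom_group)
  show ?thesis
  proof
    show "free_lift (Isom_group Y) \<phi> ` carrier (FP X)
      \<subseteq> word_value (Isom_group Y) \<phi> ` lists (nonid_partial_isometries X)"
      using * by (auto elim!: free_group_carrierE)
    show "word_value (Isom_group Y) \<phi> ` lists (nonid_partial_isometries X)
      \<subseteq> free_lift (Isom_group Y) \<phi> ` carrier (FP X)"
      using * free_group_class_carrier by (metis (no_types, lifting) image_eqI image_subsetI)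
  qed
qed

lemma word_value_Cons:
  assumes "p \<in> nonid_partial_isometries X" "w \<in> lists (nonid_partial_isometries X)"
  shows "word_value (Isom_group Y) \<phi> (p # w) = compose (mspace Y) (\<phi> p) (word_value (Isom_group Y) \<phi> w)"
proof -
  have "word_value (Isom_group Y) \<phi> (p # w) = \<phi> p \<otimes>\<^bsub>Isom_group Y\<^esub> word_value (Isom_group Y) \<phi> w"
    by (simp add: word_value_def)
  then show ?thesis using assms S_extensionD word_value_Isom by (simp add: mult_Isom_group)
qed

text \<open>Values of words are extensional on \<open>Y\<close>. Evaluation at a point replaces them
  by iteration of maps \<open>\<psi> p\<close> that may live on a larger set, so that words in two
  different S-extensions can be compared.\<close>

lemma word_value_apply:
  assumes "w \<in> lists (nonid_partial_isometries X)" "y \<in> mspace Y"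
    and "\<And>p z. p \<in> nonid_partial_isometries X \<Longrightarrow> z \<in> mspace Y \<Longrightarrow> \<phi> p z = \<psi> p z"
  shows "word_value (Isom_group Y) \<phi> w y = foldr \<psi> w y"
  using assms(1)
proof (induction w)
  case Nil
  then show ?case using assms(2) by (simp add: word_value_def one_Isom_group)
next
  case (Cons p w)
  have "word_value (Isom_group Y) \<phi> w y \<in> mspace Y"
    using Isom_groupD(3)[OF word_value_Isom] Cons.hyps(2) assms(2) by (simp add: in_lists_conv_set)
  then show ?case
    using Cons assms(2,3) by (simp add: word_value_Cons compose_def)
qed

lemma minimal_S_extension_iff:
  assumes \<psi>: "\<And>p z. p \<in> nonid_partial_isometries X \<Longrightarrow> z \<in> mspace Y \<Longrightarrow> \<phi> p z = \<psi> p z"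
  shows "minimal_S_extension X Y \<phi> \<longleftrightarrow> (\<forall>y\<in>mspace Y. \<exists>w\<in>lists (nonid_partial_isometries X).
    \<exists>x\<in>mspace X. y = foldr \<psi> w x)"
proof -
  have "(\<exists>g\<in>carrier (FP X). \<exists>x\<in>mspace X. y = free_lift (Isom_group Y) \<phi> g x) \<longleftrightarrow>
      (\<exists>f\<in>free_lift (Isom_group Y) \<phi> ` carrier (FP X). \<exists>x\<in>mspace X. y = f x)" for y
    by blast
  also have "\<dots> y \<longleftrightarrow> (\<exists>w\<in>lists (nonid_partial_isometries X).
      \<exists>x\<in>mspace X. y = word_value (Isom_group Y) \<phi> w x)" for y
    unfolding free_lift_range by blast
  also have "\<dots> y \<longleftrightarrow> (\<exists>w\<in>lists (nonid_partial_isometries X). \<exists>x\<in>mspace X. y = foldr \<psi> w x)" for y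
  proof -
    have "x \<in> mspace Y" if "x \<in> mspace X" for x
      using S that by (auto simp: S_extension_def metric_extends_def)
    then show ?thesis using word_value_apply[OF _ _ \<psi>] by (metis (no_types, lifting))
  qed
  finally show ?thesis using S unfolding minimal_S_extension_def by simp
qed

end

text \<open>One direction of \<open>rel\<close> makes the map on values of words well defined, the
  other makes it injective. Every element of the first image group is the value of a word, so the
  values at generators determine the homomorphism.\<close>

lemma ex1_coherent_homomorphism:
  assumes S1: "S_extension X\<^sub>1 Y\<^sub>1 \<phi>\<^sub>1" and S2: "S_extension X\<^sub>2 Y\<^sub>2 \<phi>\<^sub>2"
    and P: "nonid_partial_isometries X\<^sub>1 \<subseteq> nonid_partial_isometries X\<^sub>2"
    and rel: "\<And>u v. u \<in> lists (nonid_partial_isometries X\<^sub>1) \<Longrightarrow> v \<in> lists (nonid_partial_isometries X\<^sub>1) \<Longrightarrow>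
      word_value (Isom_group Y\<^sub>1) \<phi>\<^sub>1 u = word_value (Isom_group Y\<^sub>1) \<phi>\<^sub>1 v \<longleftrightarrow>
      word_value (Isom_group Y\<^sub>2) \<phi>\<^sub>2 u = word_value (Isom_group Y\<^sub>2) \<phi>\<^sub>2 v"
  shows "\<exists>!h. h \<in> mon (image_group X\<^sub>1 Y\<^sub>1 \<phi>\<^sub>1) (image_group X\<^sub>2 Y\<^sub>2 \<phi>\<^sub>2) \<and>
    h \<in> extensional (carrier (image_group X\<^sub>1 Y\<^sub>1 \<phi>\<^sub>1)) \<and>
    (\<forall>p\<in>nonid_partial_isometries X\<^sub>1. h (\<phi>\<^sub>1 p) = \<phi>\<^sub>2 p)"
proof -
  let ?G = "Isom_group Y\<^sub>1" and ?H = "Isom_group Y\<^sub>2"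
  interpret G: group ?G by (rule group_Isom_group)
  interpret H: group ?H by (rule group_Isom_group)
  define L where "L = lists (nonid_partial_isometries X\<^sub>1)"
  define a where "a = word_value ?G \<phi>\<^sub>1"
  define b where "b = word_value ?H \<phi>\<^sub>2"
  have rel: "a u = a v \<longleftrightarrow> b u = b v" if "u \<in> L" "v \<in> L" for u v
    using rel that unfolding a_def b_def L_def .
  have L2: "u \<in> lists (nonid_partial_isometries X\<^sub>2)" if "u \<in> L" for u
    using that P lists_mono unfolding L_def by blast
  have a: "a u \<in> carrier ?G" if "u \<in> L" for u
    using word_value_Isom[OF S1] that unfolding a_def L_def carrier_Isom_group .
  have b: "b u \<in> carrier ?H" if "u \<in> L" for u
    using word_value_Isom[OF S2 L2[OF that]] unfolding b_def carrier_Isom_group .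
  have \<phi>: "\<phi>\<^sub>1 p \<in> carrier ?G" "\<phi>\<^sub>2 p \<in> carrier ?H" if "p \<in> nonid_partial_isometries X\<^sub>1" for p
    using S_extensionD(1)[OF S1 that] S_extensionD(1)[OF S2, of p] that P
    by (auto simp: carrier_Isom_group)
  have a_single: "a [p] = \<phi>\<^sub>1 p" and b_single: "b [p] = \<phi>\<^sub>2 p"
    if "p \<in> nonid_partial_isometries X\<^sub>1" for p
    using \<phi>[OF that] by (simp_all add: a_def b_def word_value_def)
  have a_app: "a (u @ v) = a u \<otimes>\<^bsub>?G\<^esub> a v" if "u \<in> L" "v \<in> L" for u v
    unfolding a_def using G.is_group S_extensionD[OF S1] that
    by (intro word_value_append[where i = pinv]) (auto simp: carrier_Isom_group L_def)
  have b_app: "b (u @ v) = b u \<otimes>\<^bsub>?H\<^esub> b v" if "u \<in> L" "v \<in> L" for u v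
    unfolding b_def using H.is_group S_extensionD[OF S2] L2[OF that(1)] L2[OF that(2)]
    by (intro word_value_append[where i = pinv]) (auto simp: carrier_Isom_group)
  have app_L: "u @ v \<in> L" if "u \<in> L" "v \<in> L" for u v using that by (simp add: L_def)
  have K1: "carrier (image_group X\<^sub>1 Y\<^sub>1 \<phi>\<^sub>1) = a ` L"
    using free_lift_range[OF S1] by (simp add: image_group_def a_def L_def)
  have K2: "b ` L \<subseteq> carrier (image_group X\<^sub>2 Y\<^sub>2 \<phi>\<^sub>2)" "carrier (image_group X\<^sub>2 Y\<^sub>2 \<phi>\<^sub>2) \<subseteq> carrier ?H"
    using free_lift_range[OF S2] word_value_Isom[OF S2] L2
    by (auto simp: image_group_def b_def carrier_Isom_group)
  have mult: "x \<otimes>\<^bsub>image_group X Y \<phi>\<^esub> y = x \<otimes>\<^bsub>Isom_group Y\<^esub> y" for X Y :: "'b metric" and \<phi> x y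
    by (simp add: image_group_def)
  \<comment> \<open>Each value is represented by an arbitrary word; \<open>rel\<close> makes the
    choice irrelevant.\<close>
  define h where "h = (\<lambda>k\<in>a ` L. b (SOME u. u \<in> L \<and> a u = k))"
  have h: "h (a u) = b u" if u: "u \<in> L" for u
  proof -
    have "(SOME v. v \<in> L \<and> a v = a u) \<in> L \<and> a (SOME v. v \<in> L \<and> a v = a u) = a u"
      by (rule someI[of _ u]) (simp add: u)
    then show ?thesis using rel[of "SOME v. v \<in> L \<and> a v = a u" u] u by (simp add: h_def)
  qed
  show ?thesis
  proof (rule ex1I[of _ h], intro conjI)
    show "h \<in> mon (image_group X\<^sub>1 Y\<^sub>1 \<phi>\<^sub>1) (image_group X\<^sub>2 Y\<^sub>2 \<phi>\<^sub>2)"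
      unfolding mon_def
    proof (intro CollectI conjI homI)
      show "h x \<in> carrier (image_group X\<^sub>2 Y\<^sub>2 \<phi>\<^sub>2)" if "x \<in> carrier (image_group X\<^sub>1 Y\<^sub>1 \<phi>\<^sub>1)" for x
        using that K2(1) h unfolding K1 by auto
      show "h (x \<otimes>\<^bsub>image_group X\<^sub>1 Y\<^sub>1 \<phi>\<^sub>1\<^esub> y) = h x \<otimes>\<^bsub>image_group X\<^sub>2 Y\<^sub>2 \<phi>\<^sub>2\<^esub> h y"
        if xy: "x \<in> carrier (image_group X\<^sub>1 Y\<^sub>1 \<phi>\<^sub>1)" "y \<in> carrier (image_group X\<^sub>1 Y\<^sub>1 \<phi>\<^sub>1)" for x y
      proof -
        obtain u v where "u \<in> L" "v \<in> L" "x = a u" "y = a v" using xy unfolding K1 by blast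
        then show ?thesis by (simp add: mult h b_app app_L flip: a_app)
      qed
      show "inj_on h (carrier (image_group X\<^sub>1 Y\<^sub>1 \<phi>\<^sub>1))"
        unfolding K1 by (auto intro!: inj_onI simp: h rel)
    qed
    show "h \<in> extensional (carrier (image_group X\<^sub>1 Y\<^sub>1 \<phi>\<^sub>1))" unfolding K1 h_def by simp
    show "\<forall>p\<in>nonid_partial_isometries X\<^sub>1. h (\<phi>\<^sub>1 p) = \<phi>\<^sub>2 p"
      using h a_single b_single by (metis L_def Cons_in_lists_iff lists.Nil)
  next
    fix h' assume h': "h' \<in> mon (image_group X\<^sub>1 Y\<^sub>1 \<phi>\<^sub>1) (image_group X\<^sub>2 Y\<^sub>2 \<phi>\<^sub>2) \<and>
      h' \<in> extensional (carrier (image_group X\<^sub>1 Y\<^sub>1 \<phi>\<^sub>1)) \<and>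
      (\<forall>p\<in>nonid_partial_isometries X\<^sub>1. h' (\<phi>\<^sub>1 p) = \<phi>\<^sub>2 p)"
    then have hom: "h' \<in> hom (image_group X\<^sub>1 Y\<^sub>1 \<phi>\<^sub>1) (image_group X\<^sub>2 Y\<^sub>2 \<phi>\<^sub>2)" by (simp add: mon_def)
    have h'_mult: "h' (a u \<otimes>\<^bsub>?G\<^esub> a v) = h' (a u) \<otimes>\<^bsub>?H\<^esub> h' (a v)" if "u \<in> L" "v \<in> L" for u v
      using hom_mult[OF hom, of "a u" "a v"] that by (simp add: K1 mult)
    have h'_closed: "h' (a u) \<in> carrier ?H" if "u \<in> L" for u
      using hom_in_carrier[OF hom, of "a u"] that K2(2) K1 by blast
    have "h' (a u) = b u" if "u \<in> L" for u
      using that unfolding L_def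
    proof (induction u)
      case Nil
      \<comment> \<open>A member of \<open>hom\<close> is only known to be multiplicative, so the
        empty word needs an argument: its image is idempotent in a group.\<close>
      have "[] \<in> L" by (simp add: L_def)
      then have "h' (a []) \<otimes>\<^bsub>?H\<^esub> h' (a []) = h' (a [])" "h' (a []) \<in> carrier ?H"
        using h'_mult[of "[]" "[]"] h'_closed[of "[]"] by (simp_all flip: a_app)
      then have "h' (a []) = \<one>\<^bsub>?H\<^esub>" by (simp add: H.l_cancel_one)
      then show ?case by (simp add: b_def word_value_def)
    next
      case (Cons p u)
      then have L: "[p] \<in> L" "u \<in> L" by (auto simp: L_def)
      have "h' (a (p # u)) = h' (a [p]) \<otimes>\<^bsub>?H\<^esub> h' (a u)"
        using a_app[OF L] h'_mult[OF L] by simp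
      also have "\<dots> = b [p] \<otimes>\<^bsub>?H\<^esub> b u"
        using Cons h' a_single[of p] b_single[of p] by simp
      also have "\<dots> = b (p # u)" using b_app[OF L] by simp
      finally show ?case .
    qed
    then show "h' = h"
      using h' h unfolding K1 by (intro extensionalityI[of h' "a ` L" h]) (auto simp: h_def)
  qed
qed

section \<open>Coherent extension of minimal S-extensions\<close>

definition graph_of :: "'a set \<Rightarrow> ('a \<Rightarrow> 'a) \<Rightarrow> ('a \<rightharpoonup> 'a)"
  where "graph_of A f = (\<lambda>x. if x \<in> A then Some (f x) else None)"

lemma dom_graph_of: "dom (graph_of A f) = A"
  by (auto simp: graph_of_def dom_def)

lemma ran_graph_of: "ran (graph_of A f) = f ` A"
  by (auto simp: graph_of_def ran_def)

lemma graph_of_comp: "(\<And>x. x \<in> A \<Longrightarrow> g x \<in> A) \<Longrightarrow> graph_of A f \<circ>\<^sub>m graph_of A g = graph_of A (compose A f g)"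
  by (rule ext) (simp add: graph_of_def map_comp_def compose_def)

text \<open>An isometry of \<open>Y\<^sub>1\<close> is itself a partial isometry of \<open>X\<^sub>2 \<union> Y\<^sub>1\<close>, so a coherent action of the
  partial isometries of \<open>X\<^sub>2 \<union> Y\<^sub>1\<close> restricts to an action of the isometry group of \<open>Y\<^sub>1\<close>.
  Therefore \<open>p\<close> is sent to the extension of \<open>\<phi>\<^sub>1 p\<close> whenever \<open>\<phi>\<^sub>1 p\<close> is defined.\<close>

lemma coherent_minimal_S_extension:
  assumes U: "\<And>Z. finite Z \<Longrightarrow> Z \<subseteq> mspace U \<Longrightarrow> coherently_extensible_at U Z"
    and X: "X\<^sub>1 \<subseteq> X\<^sub>2" "X\<^sub>2 \<subseteq> mspace U" "finite X\<^sub>2" and Y1: "Y\<^sub>1 \<subseteq> mspace U" "finite Y\<^sub>1"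
    and min: "minimal_S_extension (submetric U X\<^sub>1) (submetric U Y\<^sub>1) \<phi>\<^sub>1"
  shows "\<exists>Y\<^sub>2 \<phi>\<^sub>2. Y\<^sub>2 \<subseteq> mspace U \<and> finite Y\<^sub>2 \<and>
    minimal_S_extension (submetric U X\<^sub>2) (submetric U Y\<^sub>2) \<phi>\<^sub>2 \<and>
    coherent (submetric U X\<^sub>1) (submetric U Y\<^sub>1) \<phi>\<^sub>1 (submetric U X\<^sub>2) (submetric U Y\<^sub>2) \<phi>\<^sub>2"
proof -
  define N1 where "N1 = submetric U Y\<^sub>1"
  let ?M1 = "submetric U X\<^sub>1" and ?M2 = "submetric U X\<^sub>2"
  define P1 where "P1 = nonid_partial_isometries ?M1"
  define P2 where "P2 = nonid_partial_isometries ?M2"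
  define Z where "Z = X\<^sub>2 \<union> Y\<^sub>1"
  have space: "mspace ?M1 = X\<^sub>1" "mspace ?M2 = X\<^sub>2" "mspace N1 = Y\<^sub>1" using X Y1 by (auto simp: N1_def)
  have dist_N1: "mdist N1 = mdist U" by (simp add: N1_def)
  have S1: "S_extension ?M1 N1 \<phi>\<^sub>1" using min by (simp add: minimal_S_extension_def N1_def)
  have X1: "X\<^sub>1 \<subseteq> Y\<^sub>1" using S1 space by (simp add: S_extension_def metric_extends_def)
  have P12: "P1 \<subseteq> P2"
    unfolding P1_def P2_def nonid_partial_isometries_def
    using partial_isometries_submetric_mono[OF X(1)] by blast
  \<comment> \<open>Generators in \<open>P1\<close> and outside it will be treated differently; a
    generator and its inverse must fall under the same case.\<close>
  have P1_iff: "pinv p \<in> P1 \<longleftrightarrow> p \<in> P1" if "p \<in> P2" for p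
  proof -
    have "pinv (pinv p) = p"
      using that pinv_pinv by (auto simp: P2_def nonid_partial_isometries_def)
    then show ?thesis using pinv_nonid_partial_isometries unfolding P1_def by metis
  qed
  have P2_pinv: "pinv p \<in> P2" if "p \<in> P2" for p
    using that unfolding P2_def by (rule pinv_nonid_partial_isometries)
  have "finite Z" "Z \<subseteq> mspace U" using X Y1 by (auto simp: Z_def)
  then obtain W \<Phi> where W: "finite W" "Z \<subseteq> W" "W \<subseteq> mspace U"
    and \<Phi>: "coherent_action (submetric U Z) W (\<lambda>x. x) \<Phi>"
      "isometric_action (submetric U Z) (submetric U W) \<Phi>"
    using U[of Z] unfolding coherently_extensible_at_def by blast
  let ?PZ = "partial_isometries (submetric U Z)"
  have \<Phi>_dist: "mdist U (\<Phi> p x) (\<Phi> p y) = mdist U x y" if "p \<in> ?PZ" "x \<in> W" "y \<in> W" for p x y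
    using \<Phi>(2) that W(3) by (auto simp: isometric_action_def)

  let ?t = "graph_of Y\<^sub>1"
  note isoD = Isom_groupD[of _ N1, unfolded space dist_N1]
  have tZ: "?t f \<in> ?PZ" if "f \<in> Isom N1" for f
    using isoD[OF that] Y1 \<open>Z \<subseteq> mspace U\<close>
    by (auto simp: partial_isometries_def dom_graph_of ran_graph_of Z_def) (auto simp: graph_of_def)
  \<comment> \<open>All isometries of \<open>Y\<^sub>1\<close> have domain and range
    \<open>Y\<^sub>1\<close>, so any two are composable, and coherence of \<open>\<Phi>\<close>
    yields an action of their whole group on \<open>W\<close>.\<close>
  have t_comp: "\<Phi> (?t (compose Y\<^sub>1 f g)) v = \<Phi> (?t f) (\<Phi> (?t g) v)"
    if "f \<in> Isom N1" "g \<in> Isom N1" "v \<in> W" for f g v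
  proof -
    have "g ` Y\<^sub>1 = Y\<^sub>1" using isoD(1)[OF that(2)] by (simp add: bij_betw_def)
    then have "dom (?t f) = ran (?t g)" by (simp add: dom_graph_of ran_graph_of)
    then show ?thesis
      using coherent_actionD(4)[OF \<Phi>(1) tZ[OF that(2)] tZ[OF that(1)] _ that(3)]
        graph_of_comp[of Y\<^sub>1 g f] isoD(3)[OF that(2)] by simp
  qed
  interpret N1: group "Isom_group N1" by (rule group_Isom_group)
  have one_N1: "(\<lambda>x\<in>Y\<^sub>1. x) \<in> Isom N1"
    using N1.one_closed by (simp add: carrier_Isom_group one_Isom_group space)
  have t_one: "\<Phi> (?t (\<lambda>x\<in>Y\<^sub>1. x)) v = v" if "v \<in> W" for v
  proof (rule coherent_action_idem[OF \<Phi>(1) tZ[OF one_N1] _ that])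
    show "?t (\<lambda>x\<in>Y\<^sub>1. x) x = Some x" if "x \<in> dom (?t (\<lambda>x\<in>Y\<^sub>1. x))" for x
      using that unfolding dom_graph_of by (simp add: graph_of_def)
  qed
  have t_ext: "\<Phi> (?t f) y = f y" if "f \<in> Isom N1" "y \<in> Y\<^sub>1" for f y
    using coherent_actionD(3)[OF \<Phi>(1) tZ[OF that(1)], of y] that(2)
    by (simp add: dom_graph_of) (simp add: graph_of_def)

  define \<theta> where "\<theta> p = (if p \<in> P1 then ?t (\<phi>\<^sub>1 p) else p)" for p
  define \<psi> where "\<psi> p = \<Phi> (\<theta> p)" for p
  have \<phi>1: "\<phi>\<^sub>1 p \<in> Isom N1" "extends_partial (\<phi>\<^sub>1 p) p" "\<phi>\<^sub>1 (pinv p) = inv\<^bsub>Isom_group N1\<^esub> (\<phi>\<^sub>1 p)"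
    if "p \<in> P1" for p
    using S_extensionD[OF S1] that by (auto simp: P1_def)
  have P2D: "p \<in> ?PZ" "dom p \<subseteq> X\<^sub>2" if "p \<in> P2" for p
  proof -
    have p: "p \<in> partial_isometries ?M2" using that by (simp add: P2_def nonid_partial_isometries_def)
    then show "p \<in> ?PZ" using partial_isometries_submetric_mono[of X\<^sub>2 Z U] by (auto simp: Z_def)
    show "dom p \<subseteq> X\<^sub>2" using partial_isometriesD(2)[OF p] by (simp add: space)
  qed
  have \<theta>: "\<theta> p \<in> ?PZ" if "p \<in> P2" for p
    using that P2D(1) tZ \<phi>1(1) by (simp add: \<theta>_def)
  have \<psi>_W: "\<psi> p v \<in> W" if "p \<in> P2" "v \<in> W" for p v
    using coherent_actionD(2)[OF \<Phi>(1) \<theta>] that by (simp add: \<psi>_def)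
  have \<psi>_Y1: "\<psi> p y = \<phi>\<^sub>1 p y" if "p \<in> P1" "y \<in> Y\<^sub>1" for p y
    using that t_ext[OF \<phi>1(1)] by (simp add: \<psi>_def \<theta>_def)
  have \<psi>_ext: "p x = Some (\<psi> p x)" if p: "p \<in> P2" and x: "x \<in> dom p" for p x
  proof (cases "p \<in> P1")
    case True
    have "p \<in> partial_isometries ?M1" using True by (simp add: P1_def nonid_partial_isometries_def)
    then have "x \<in> Y\<^sub>1" using partial_isometriesD(2) x X1 space(1) by blast
    then show ?thesis using \<phi>1(2)[OF True] x \<psi>_Y1[OF True] by (simp add: extends_partial_def)
  next
    case False
    then show ?thesis
      using coherent_actionD(3)[OF \<Phi>(1) P2D(1)[OF p] x] x by (auto simp: \<psi>_def \<theta>_def)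
  qed
  have \<psi>_pinv: "\<psi> (pinv p) (\<psi> p v) = v" if p: "p \<in> P2" and v: "v \<in> W" for p v
  proof (cases "p \<in> P1")
    case True
    have i: "inv\<^bsub>Isom_group N1\<^esub> (\<phi>\<^sub>1 p) \<in> Isom N1"
      using N1.inv_closed[of "\<phi>\<^sub>1 p"] \<phi>1(1)[OF True] by (simp add: carrier_Isom_group)
    have "compose Y\<^sub>1 (inv\<^bsub>Isom_group N1\<^esub> (\<phi>\<^sub>1 p)) (\<phi>\<^sub>1 p) = (\<lambda>x\<in>Y\<^sub>1. x)"
      using N1.l_inv[of "\<phi>\<^sub>1 p"] \<phi>1(1)[OF True] mult_Isom_group[OF i \<phi>1(1)[OF True]]
      by (simp add: carrier_Isom_group one_Isom_group space)
    then show ?thesis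
      using t_comp[OF i \<phi>1(1)[OF True] v] t_one[OF v] True P1_iff[OF p] \<phi>1(3)[OF True]
      by (simp add: \<psi>_def \<theta>_def)
  next
    case False
    then show ?thesis
      using coherent_action_pinv[OF \<Phi>(1) P2D(1)[OF p] v] P1_iff[OF p] by (simp add: \<psi>_def \<theta>_def)
  qed

  \<comment> \<open>The orbit of \<open>X\<^sub>2\<close> under the words: cutting \<open>W\<close>
    down to it ensures minimality.\<close>
  define Y2 where "Y2 = {foldr \<psi> w x | w x. w \<in> lists P2 \<and> x \<in> X\<^sub>2}"
  have fold_W: "foldr \<psi> w v \<in> W" if "w \<in> lists P2" "v \<in> W" for w v
    using that by (induction w) (auto simp: \<psi>_W)
  have X2W: "X\<^sub>2 \<subseteq> W" "Y\<^sub>1 \<subseteq> W" using W(2) by (auto simp: Z_def)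
  have Y2W: "Y2 \<subseteq> W" using fold_W X2W by (auto simp: Y2_def)
  have X2Y2: "X\<^sub>2 \<subseteq> Y2" unfolding Y2_def by (force intro: exI[of _ "[]"])
  have \<psi>_Y2: "\<psi> p y \<in> Y2" if p: "p \<in> P2" and y: "y \<in> Y2" for p y
  proof -
    obtain w x where "w \<in> lists P2" "x \<in> X\<^sub>2" "y = foldr \<psi> w x" using y by (auto simp: Y2_def)
    then have "p # w \<in> lists P2" "\<psi> p y = foldr \<psi> (p # w) x" using p by auto
    then show ?thesis using \<open>x \<in> X\<^sub>2\<close> unfolding Y2_def by blast
  qed
  have fin: "finite Y2" using Y2W W(1) by (rule finite_subset)
  define N2 where "N2 = submetric U Y2"
  have N2: "mspace N2 = Y2" "mdist N2 = mdist U" using Y2W W(3) by (auto simp: N2_def)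
  define \<phi>2 where "\<phi>2 p = restrict (\<psi> p) Y2" for p
  have \<phi>2: "\<phi>2 p \<in> Isom N2" if p: "p \<in> P2" for p
  proof -
    have "inj_on (\<psi> p) Y2"
      using \<psi>_pinv[OF p] Y2W by (metis inj_onI subsetD)
    then have "\<psi> p ` Y2 = Y2"
      using \<psi>_Y2[OF p] by (intro endo_inj_surj[OF fin]) auto
    then have "bij_betw (\<psi> p) Y2 Y2" using \<open>inj_on (\<psi> p) Y2\<close> by (simp add: bij_betw_def)
    moreover have "mdist U (\<psi> p x) (\<psi> p y) = mdist U x y" if "x \<in> Y2" "y \<in> Y2" for x y
      using \<Phi>_dist[OF \<theta>[OF p]] that Y2W by (auto simp: \<psi>_def)
    ultimately show ?thesis using restrict_Isom[of "\<psi> p" N2] by (simp add: N2 \<phi>2_def)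
  qed
  interpret N2: group "Isom_group N2" by (rule group_Isom_group)
  have S2: "S_extension ?M2 N2 \<phi>2"
    unfolding S_extension_def P2_def[symmetric]
  proof (intro conjI ballI)
    show "finite (mspace ?M2)" using X(3) by simp
    show "metric_extends N2 ?M2" using X2Y2 X(2) by (auto simp: metric_extends_def N2)
    fix p assume p: "p \<in> P2"
    show "\<phi>2 p \<in> Isom N2" using \<phi>2[OF p] .
    show "extends_partial (\<phi>2 p) p"
      using \<psi>_ext[OF p] P2D(2)[OF p] X2Y2 by (auto simp: extends_partial_def \<phi>2_def)
    have "\<phi>2 (pinv p) \<otimes>\<^bsub>Isom_group N2\<^esub> \<phi>2 p = \<one>\<^bsub>Isom_group N2\<^esub>"
      using mult_Isom_group[OF \<phi>2[OF P2_pinv[OF p]] \<phi>2[OF p]] \<psi>_pinv[OF p] \<psi>_Y2[OF p] Y2W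
      by (auto simp: one_Isom_group N2 compose_def \<phi>2_def fun_eq_iff)
    then show "\<phi>2 (pinv p) = inv\<^bsub>Isom_group N2\<^esub> (\<phi>2 p)"
      using N2.inv_equality \<phi>2[OF p] \<phi>2[OF P2_pinv[OF p]] by (simp add: carrier_Isom_group)
  qed
  have min2: "minimal_S_extension ?M2 N2 \<phi>2"
  proof -
    have "minimal_S_extension ?M2 N2 \<phi>2 \<longleftrightarrow>
        (\<forall>y\<in>mspace N2. \<exists>w\<in>lists P2. \<exists>x\<in>mspace ?M2. y = foldr \<psi> w x)"
      unfolding P2_def by (rule minimal_S_extension_iff[OF S2]) (simp add: N2 \<phi>2_def)
    then show ?thesis unfolding N2 space Y2_def by blast
  qed
  \<comment> \<open>Minimality of \<open>Y\<^sub>1\<close> enters here: its points are reached from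
    \<open>X\<^sub>1\<close> by words, and on \<open>Y\<^sub>1\<close> the maps
    \<open>\<psi> p\<close> agree with \<open>\<phi>\<^sub>1 p\<close>.\<close>
  have Y12: "Y\<^sub>1 \<subseteq> Y2"
  proof
    fix y assume y: "y \<in> Y\<^sub>1"
    have "\<forall>y\<in>Y\<^sub>1. \<exists>w\<in>lists P1. \<exists>x\<in>X\<^sub>1. y = foldr \<psi> w x"
      using minimal_S_extension_iff[OF S1, of \<psi>] min \<psi>_Y1
      unfolding space P1_def[symmetric] N1_def[symmetric] by simp
    then obtain w x where "w \<in> lists P1" "x \<in> X\<^sub>1" "y = foldr \<psi> w x" using y by blast
    then show "y \<in> Y2" using X(1) lists_mono[OF P12] unfolding Y2_def by blast
  qed
  have wv1: "word_value (Isom_group N1) \<phi>\<^sub>1 w y = foldr \<psi> w y" if "w \<in> lists P1" "y \<in> Y\<^sub>1" for w y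
    by (rule word_value_apply[OF S1]) (use that \<psi>_Y1 space in \<open>auto simp: P1_def\<close>)
  have wv2: "word_value (Isom_group N2) \<phi>2 w y = foldr \<psi> w y" if "w \<in> lists P1" "y \<in> Y2" for w y
    by (rule word_value_apply[OF S2]) (use that P12 in \<open>auto simp: P2_def N2 \<phi>2_def\<close>)
  \<comment> \<open>The action of a word on all of \<open>W\<close> depends only on its value as an
    isometry of \<open>Y\<^sub>1\<close>. Hence relations among the \<open>\<phi>\<^sub>1 p\<close>
    persist, which is the forward direction of \<open>rel\<close>; the backward one is restriction
    to \<open>Y\<^sub>1\<close>.\<close>
  have \<Phi>_wv1: "\<Phi> (?t (word_value (Isom_group N1) \<phi>\<^sub>1 w)) v = foldr \<psi> w v" if "w \<in> lists P1" "v \<in> W" for w v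
    using that(1)
  proof (induction w)
    case Nil
    have "word_value (Isom_group N1) \<phi>\<^sub>1 [] = (\<lambda>x\<in>Y\<^sub>1. x)"
      unfolding one_Isom_group[of N1, unfolded space, symmetric] by (simp add: word_value_def)
    then show ?case by (simp only: foldr_Nil id_apply t_one[OF that(2)])
  next
    case (Cons p w)
    have wI: "word_value (Isom_group N1) \<phi>\<^sub>1 w \<in> Isom N1"
      by (rule word_value_Isom[OF S1]) (use Cons.hyps(2) in \<open>simp add: P1_def\<close>)
    have "word_value (Isom_group N1) \<phi>\<^sub>1 (p # w) = compose Y\<^sub>1 (\<phi>\<^sub>1 p) (word_value (Isom_group N1) \<phi>\<^sub>1 w)"
      using word_value_Cons[OF S1] Cons.hyps by (simp add: P1_def space)
    then show ?case
      using t_comp[OF \<phi>1(1)[OF Cons.hyps(1)] wI that(2)] Cons.IH Cons.hyps(1) by (simp add: \<psi>_def \<theta>_def)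
  qed
  have rel: "word_value (Isom_group N1) \<phi>\<^sub>1 u = word_value (Isom_group N1) \<phi>\<^sub>1 v \<longleftrightarrow>
      word_value (Isom_group N2) \<phi>2 u = word_value (Isom_group N2) \<phi>2 v"
    if uv: "u \<in> lists P1" "v \<in> lists P1" for u v
  proof
    assume eq: "word_value (Isom_group N1) \<phi>\<^sub>1 u = word_value (Isom_group N1) \<phi>\<^sub>1 v"
    have "u \<in> lists P2" "v \<in> lists P2" using uv lists_mono[OF P12] by auto
    then have "word_value (Isom_group N2) \<phi>2 u \<in> extensional Y2" "word_value (Isom_group N2) \<phi>2 v \<in> extensional Y2"
      using word_value_Isom[OF S2, folded P2_def, THEN Isom_groupD(2)] by (auto simp: N2)
    then show "word_value (Isom_group N2) \<phi>2 u = word_value (Isom_group N2) \<phi>2 v"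
    proof (rule extensionalityI)
      fix y assume "y \<in> Y2"
      then show "word_value (Isom_group N2) \<phi>2 u y = word_value (Isom_group N2) \<phi>2 v y"
        using wv2 uv \<Phi>_wv1[OF uv(1)] \<Phi>_wv1[OF uv(2)] eq Y2W by (metis subsetD)
    qed
  next
    assume eq: "word_value (Isom_group N2) \<phi>2 u = word_value (Isom_group N2) \<phi>2 v"
    have "word_value (Isom_group N1) \<phi>\<^sub>1 u \<in> extensional Y\<^sub>1" "word_value (Isom_group N1) \<phi>\<^sub>1 v \<in> extensional Y\<^sub>1"
      using uv word_value_Isom[OF S1, folded P1_def, THEN Isom_groupD(2)] by (auto simp: space)
    then show "word_value (Isom_group N1) \<phi>\<^sub>1 u = word_value (Isom_group N1) \<phi>\<^sub>1 v"
    proof (rule extensionalityI)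
      fix y assume "y \<in> Y\<^sub>1"
      then show "word_value (Isom_group N1) \<phi>\<^sub>1 u y = word_value (Isom_group N1) \<phi>\<^sub>1 v y"
        using wv1 wv2 uv eq Y12 by (metis subsetD)
    qed
  qed
  have "coherent ?M1 N1 \<phi>\<^sub>1 ?M2 N2 \<phi>2"
    unfolding coherent_def
  proof (intro conjI)
    show "metric_extends N2 N1" using Y12 by (simp add: metric_extends_def N2 space dist_N1)
    show "\<forall>p\<in>nonid_partial_isometries ?M1. \<forall>y\<in>mspace N1. \<phi>2 p y = \<phi>\<^sub>1 p y"
      using \<psi>_Y1 Y12 unfolding space P1_def[symmetric] by (auto simp: \<phi>2_def)
    show "\<exists>!h. h \<in> mon (image_group ?M1 N1 \<phi>\<^sub>1) (image_group ?M2 N2 \<phi>2) \<and>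
        h \<in> extensional (carrier (image_group ?M1 N1 \<phi>\<^sub>1)) \<and>
        (\<forall>p\<in>nonid_partial_isometries ?M1. h (\<phi>\<^sub>1 p) = \<phi>2 p)"
      by (rule ex1_coherent_homomorphism[OF S1 S2]) (use P12 rel in \<open>auto simp: P1_def P2_def\<close>)
  qed
  then show ?thesis
    using min2 fin Y2W W(3) unfolding N1_def N2_def by (intro exI[of _ Y2] exI[of _ \<phi>2]) auto
qed

lemma ultraextensive_if_coherently_extensible:
  assumes count: "countable (mspace U)"
    and U: "\<And>Z. finite Z \<Longrightarrow> Z \<subseteq> mspace U \<Longrightarrow> coherently_extensible_at U Z"
  shows "ultraextensive U"
  unfolding ultraextensive_def
proof (intro conjI allI impI)
  show "ultrahomogeneous U" using assms by (rule ultrahomogeneous_if_coherently_extensible)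
next
  fix X assume X: "finite X \<and> X \<subseteq> mspace U"
  \<comment> \<open>An S-extension of \<open>X\<close> arises by extending the empty S-extension of
    the empty set.\<close>
  have "nonid_partial_isometries (submetric U {}) = {}"
    using partial_isometriesD(2)[of _ "submetric U {}"] by (fastforce simp: nonid_partial_isometries_def)
  then have "minimal_S_extension (submetric U {}) (submetric U {}) undefined"
    by (simp add: minimal_S_extension_def S_extension_def metric_extends_def)
  from coherent_minimal_S_extension[OF U _ _ _ _ _ this, of X] X
  obtain Y \<phi> where "finite Y" "Y \<subseteq> mspace U" "minimal_S_extension (submetric U X) (submetric U Y) \<phi>"
    by auto
  then show "\<exists>Y \<phi>. finite Y \<and> Y \<subseteq> mspace U \<and> S_extension (submetric U X) (submetric U Y) \<phi>"
    unfolding minimal_S_extension_def by blast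
next
  fix X\<^sub>1 X\<^sub>2 Y\<^sub>1 \<phi>\<^sub>1
  assume "X\<^sub>1 \<subseteq> X\<^sub>2 \<and> X\<^sub>2 \<subseteq> mspace U \<and> finite X\<^sub>2 \<and> Y\<^sub>1 \<subseteq> mspace U \<and> finite Y\<^sub>1 \<and>
    minimal_S_extension (submetric U X\<^sub>1) (submetric U Y\<^sub>1) \<phi>\<^sub>1"
  then show "\<exists>Y\<^sub>2 \<phi>\<^sub>2. Y\<^sub>2 \<subseteq> mspace U \<and> finite Y\<^sub>2 \<and>
    minimal_S_extension (submetric U X\<^sub>2) (submetric U Y\<^sub>2) \<phi>\<^sub>2 \<and>
    coherent (submetric U X\<^sub>1) (submetric U Y\<^sub>1) \<phi>\<^sub>1 (submetric U X\<^sub>2) (submetric U Y\<^sub>2) \<phi>\<^sub>2"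
    by (elim conjE) (rule coherent_minimal_S_extension[OF U])
qed

theorem theorem6p3:
  fixes X :: "'a metric"
  assumes "countable (mspace X)"
  shows "\<exists>Y :: ('a + nat) metric.
    countable (mspace Y) \<and> ultraextensive Y \<and>
    Inl ` mspace X \<subseteq> mspace Y \<and>
    (\<forall>x\<in>mspace X. \<forall>y\<in>mspace X. mdist Y (Inl x) (Inl y) = mdist X x y)"
proof -
  let ?C = "Inl ` mspace X \<union> range Inr :: ('a + nat) set"
  have inj: "inj_on Inl (mspace X)" by simp
  obtain M :: "('a + nat) metric" where M: "mspace M = Inl ` mspace X"
    "\<And>x y. x \<in> mspace X \<Longrightarrow> y \<in> mspace X \<Longrightarrow> mdist M (Inl x) (Inl y) = mdist X x y"
    using metric_transport[OF inj] by blast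
  have C: "countable ?C" using assms by simp
  have "range Inr \<subseteq> ?C - mspace M" unfolding M(1) by auto
  moreover have "infinite (range Inr :: ('a + nat) set)"
    using range_inj_infinite[of "Inr :: nat \<Rightarrow> 'a + nat"] by simp
  ultimately have "infinite (?C - mspace M)" using finite_subset by blast
  then obtain U where U: "metric_extends U M" "mspace U \<subseteq> ?C"
    "\<And>Z. finite Z \<Longrightarrow> Z \<subseteq> mspace U \<Longrightarrow> coherently_extensible_at U Z"
    using coherently_extensible_extension[OF C, of M] M(1) by blast
  have "countable (mspace U)" using countable_subset[OF U(2) C] .
  moreover from this U(3) have "ultraextensive U" by (rule ultraextensive_if_coherently_extensible)
  moreover have "Inl ` mspace X \<subseteq> mspace U"
    "\<forall>x\<in>mspace X. \<forall>y\<in>mspace X. mdist U (Inl x) (Inl y) = mdist X x y"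
    using U(1) M unfolding metric_extends_def by auto
  ultimately show ?thesis by blast
qed

end
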